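(* Let $G$ be a minimally $2$-edge-connected graph of order $n$. Then \[ \overline{\lambda}(G)\leq 2+\frac{(n-2)^2}{4n(n-1)}<\frac{9}{4}. \] Moreover, let $n=4k+\ell$, where $k,\ell\in\mathbb{Z}$ and $0\leq \ell<4$. (a) If $k\geq 8$ and $\ell=0$, then \[ \overline{\lambda}(G)\leq 2+\frac{n^2-4n}{4n(n-1)}, \] with equality if and only if $G$ is obtained from an ideally edge-connected $6$-regular (multi)graph of order $k$ by subdividing every edge. (b) If $k\geq 30$ and $\ell=1$, then \[ \overline{\lambda}(G)\leq 2+\frac{n^2-6n+13}{4n(n-1)}, \] with equality if and only if $G$ is obtained from an ideally edge-connected nearly regular (multi)graph of order $k$ and size $n-k$ by subdividing every edge. (c) If $k\geq 68$ and $\ell=2$, then \[ \overline{\lambda}(G)\leq 2+\frac{n^2-8n+60}{4n(n-1)}, \] with equality if and only if $G$ is obtained from an ideally edge-connected nearly regular (multi)graph of either order $k$ and size $n-k$, or order $k+1$ and size $n-k-1$, by subdividing every edge. (d) If $k\geq 30$ and $\ell=3$, then \[ \overline{\lambda}(G)\leq 2+\frac{n^2-6n+17}{4n(n-1)}, \] with equality if and only if $G$ is obtained from an ideally edge-connected nearly regular (multi)graph of order $k+1$ and size $n-k-1$ by subdividing every edge.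
   Context: Graphs are finite and may have multiple edges but no loops; the degree of a vertex counts edges with multiplicity, the order of a graph is its number of vertices and its size is its number of edges (with multiplicity). For distinct vertices $u,v$ of a graph $G$, $\lambda_G(u,v)$ denotes the maximum number of edge-disjoint $u$--$v$ paths in $G$. The average edge-connectivity of a graph $G$ of order $n$ is $\overline{\lambda}(G)=\sum_{\{u,v\}\subseteq V(G)}\lambda_G(u,v)/\binom{n}{2}$. The edge-connectivity $\lambda(G)$ of a non-trivial graph $G$ is the smallest number of edges whose removal disconnects $G$. A graph $G$ is minimally $2$-edge-connected if $\lambda(G)=2$ and $\lambda(G-e)<2$ for every edge $e$ of $G$. A graph $G$ is ideally edge-connected if $\lambda_G(u,v)=\min\{\deg(u),\deg(v)\}$ for all pairs of distinct vertices $u,v$ of $G$. A graph is nearly regular if the difference between its maximum degree and its minimum degree is at most $1$. Subdividing an edge means replacing it by a path of length $2$ through a new vertex of degree $2$ (every edge, including each of several parallel edges, is subdivided exactly once). *)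

theory Defs
  imports Complex_Main
begin

record ('v, 'e) mgraph =
  verts :: "'v set"
  edges :: "'e set"
  ends  :: "'e \<Rightarrow> 'v set"

text \<open>Parallel edges are distinct elements of \<open>edges G\<close> with the same set of ends; requiring
  two ends excludes loops.\<close>

definition multigraph :: "('v, 'e) mgraph \<Rightarrow> bool" where
  "multigraph G \<longleftrightarrow> finite (verts G) \<and> finite (edges G) \<and>
     (\<forall>e\<in>edges G. ends G e \<subseteq> verts G \<and> card (ends G e) = 2)"

definition graph_order :: "('v, 'e) mgraph \<Rightarrow> nat" where
  "graph_order G = card (verts G)"

definition graph_size :: "('v, 'e) mgraph \<Rightarrow> nat" where
  "graph_size G = card (edges G)"

definition degree :: "('v, 'e) mgraph \<Rightarrow> 'v \<Rightarrow> nat" where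
  "degree G v = card {e \<in> edges G. v \<in> ends G e}"

text \<open>A path is given by its vertex sequence together with its edge sequence.\<close>

definition is_path :: "('v, 'e) mgraph \<Rightarrow> 'v \<Rightarrow> 'v \<Rightarrow> 'v list \<times> 'e list \<Rightarrow> bool" where
  "is_path G u v p \<longleftrightarrow> (case p of (xs, es) \<Rightarrow>
     length xs = Suc (length es) \<and> hd xs = u \<and> last xs = v \<and>
     distinct xs \<and> set xs \<subseteq> verts G \<and>
     (\<forall>i<length es. es ! i \<in> edges G \<and> ends G (es ! i) = {xs ! i, xs ! Suc i}))"

definition edge_disjoint_paths ::
    "('v, 'e) mgraph \<Rightarrow> 'v \<Rightarrow> 'v \<Rightarrow> ('v list \<times> 'e list) set \<Rightarrow> bool" where
  "edge_disjoint_paths G u v P \<longleftrightarrow> finite P \<and> (\<forall>p\<in>P. is_path G u v p) \<and>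
     pairwise (\<lambda>p q. disjnt (set (snd p)) (set (snd q))) P"

text \<open>Only meaningful for distinct vertices \<open>u\<close> and \<open>v\<close>.\<close>

definition local_edge_connectivity :: "('v, 'e) mgraph \<Rightarrow> 'v \<Rightarrow> 'v \<Rightarrow> nat" where
  "local_edge_connectivity G u v = Max {card P | P. edge_disjoint_paths G u v P}"

lemma is_path_rev:
  assumes "is_path G u v (xs, es)"
  shows "is_path G v u (rev xs, rev es)"
proof -
  have len: "length xs = Suc (length es)" and xs: "xs \<noteq> []"
    using assms by (auto simp: is_path_def)
  have "rev es ! i \<in> edges G \<and> ends G (rev es ! i) = {rev xs ! i, rev xs ! Suc i}"
    if "i < length es" for i
  proof -
    define j where "j = length es - Suc i"
    have j: "j < length es" "rev es ! i = es ! j" "rev xs ! i = xs ! Suc j" "rev xs ! Suc i = xs ! j"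
      using that len by (auto simp: j_def rev_nth Suc_diff_Suc)
    then show ?thesis
      using assms by (auto simp: is_path_def)
  qed
  then show ?thesis
    using assms xs by (auto simp: is_path_def hd_rev last_rev)
qed

lemma edge_disjoint_paths_rev:
  assumes "edge_disjoint_paths G u v P"
  shows "edge_disjoint_paths G v u (map_prod rev rev ` P)"
  using assms is_path_rev[of G u v]
  by (fastforce simp: edge_disjoint_paths_def pairwise_def)

lemma local_edge_connectivity_commute:
  "local_edge_connectivity G u v = local_edge_connectivity G v u"
proof -
  have *: "{card P | P. edge_disjoint_paths G u v P} \<subseteq> {card P | P. edge_disjoint_paths G v u P}"
    for u v
  proof clarify
    fix P assume "edge_disjoint_paths G u v P"
    moreover have "card (map_prod rev rev ` P) = card P"
      by (rule card_image) (auto simp: inj_on_def)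
    ultimately show "\<exists>Q. card P = card Q \<and> edge_disjoint_paths G v u Q"
      by (metis edge_disjoint_paths_rev)
  qed
  show ?thesis
    unfolding local_edge_connectivity_def using *[of u v] *[of v u] by simp
qed

text \<open>The value of \<open>local_edge_connectivity\<close> on an unordered pair; see the lemma below for
  well-definedness.\<close>

definition pair_edge_connectivity :: "('v, 'e) mgraph \<Rightarrow> 'v set \<Rightarrow> nat" where
  "pair_edge_connectivity G p =
     (THE m. \<exists>u v. p = {u, v} \<and> m = local_edge_connectivity G u v)"

lemma pair_edge_connectivity_insert [simp]:
  "pair_edge_connectivity G {u, v} = local_edge_connectivity G u v"
  unfolding pair_edge_connectivity_def
  by (rule the_equality) (auto simp: doubleton_eq_iff local_edge_connectivity_commute)

definition avg_edge_connectivity :: "('v, 'e) mgraph \<Rightarrow> real" where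
  "avg_edge_connectivity G =
     (\<Sum>p | p \<subseteq> verts G \<and> card p = 2. real (pair_edge_connectivity G p)) /
     real (graph_order G choose 2)"

definition connected_graph :: "('v, 'e) mgraph \<Rightarrow> bool" where
  "connected_graph G \<longleftrightarrow> verts G \<noteq> {} \<and> (\<forall>u\<in>verts G. \<forall>v\<in>verts G. \<exists>p. is_path G u v p)"

definition delete_edges :: "('v, 'e) mgraph \<Rightarrow> 'e set \<Rightarrow> ('v, 'e) mgraph" where
  "delete_edges G S = G\<lparr>edges := edges G - S\<rparr>"

text \<open>Only meaningful for graphs with at least two vertices: the one-vertex graph cannot be
  disconnected by removing edges.\<close>

definition edge_connectivity :: "('v, 'e) mgraph \<Rightarrow> nat" where
  "edge_connectivity G =
     (LEAST m. \<exists>S\<subseteq>edges G. card S = m \<and> \<not> connected_graph (delete_edges G S))"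

definition minimally_2_edge_connected :: "('v, 'e) mgraph \<Rightarrow> bool" where
  "minimally_2_edge_connected G \<longleftrightarrow> graph_order G \<ge> 2 \<and> edge_connectivity G = 2 \<and>
     (\<forall>e\<in>edges G. edge_connectivity (delete_edges G {e}) < 2)"

definition ideally_edge_connected :: "('v, 'e) mgraph \<Rightarrow> bool" where
  "ideally_edge_connected G \<longleftrightarrow> (\<forall>u\<in>verts G. \<forall>v\<in>verts G. u \<noteq> v \<longrightarrow>
     local_edge_connectivity G u v = min (degree G u) (degree G v))"

definition regular :: "nat \<Rightarrow> ('v, 'e) mgraph \<Rightarrow> bool" where
  "regular d G \<longleftrightarrow> (\<forall>v\<in>verts G. degree G v = d)"

definition nearly_regular :: "('v, 'e) mgraph \<Rightarrow> bool" where
  "nearly_regular G \<longleftrightarrow> Max (degree G ` verts G) - Min (degree G ` verts G) \<le> 1"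

text \<open>The new vertex on the edge \<open>e\<close> is \<open>Inr e\<close>; the pair \<open>(e, v)\<close> is the half of \<open>e\<close>
  at its end \<open>v\<close>.\<close>

definition subdivision :: "('v, 'e) mgraph \<Rightarrow> ('v + 'e, 'e \<times> 'v) mgraph" where
  "subdivision G = \<lparr>verts = Inl ` verts G \<union> Inr ` edges G,
     edges = {(e, v). e \<in> edges G \<and> v \<in> ends G e},
     ends = (\<lambda>(e, v). {Inr e, Inl v})\<rparr>"

definition isomorphic :: "('v, 'e) mgraph \<Rightarrow> ('w, 'f) mgraph \<Rightarrow> bool" where
  "isomorphic G H \<longleftrightarrow> (\<exists>f g. bij_betw f (verts G) (verts H) \<and> bij_betw g (edges G) (edges H) \<and>
     (\<forall>e\<in>edges G. ends H (g e) = f ` ends G e))"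

text \<open>\<open>G\<close> is obtained by subdividing every edge of some multigraph with property \<open>Q\<close>. Every finite
  multigraph is isomorphic to one whose vertices and edges are natural numbers, so
  quantifying over the latter loses nothing.\<close>

definition obtained_by_subdividing ::
    "('v, 'e) mgraph \<Rightarrow> ((nat, nat) mgraph \<Rightarrow> bool) \<Rightarrow> bool" where
  "obtained_by_subdividing G Q \<longleftrightarrow> (\<exists>H. multigraph H \<and> Q H \<and> isomorphic G (subdivision H))"

end

theory Submission
  imports Defs "HOL-Library.Disjoint_Sets"
begin

text \<open>Call two vertices tied if no cut with at most two edges separates them. Every edge of \<open>G\<close> lies in
  such a cut, so splitting \<open>G\<close> along these cuts shows that it has at most \<open>2 (N - 1)\<close> edges, where \<open>N\<close>
  is the number of classes of tied vertices. With \<open>a v = deg v - 2\<close>, a pair has connectivity at most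
  \<open>2 + min (a u) (a v)\<close> inside a class and at most \<open>2\<close> otherwise. If the largest class has \<open>s\<close>
  vertices, the sum of \<open>a\<close> over the nontrivial classes is at most \<open>2n - 4s\<close>. The sum of the minima is
  the sum of \<open>m choose 2\<close> over the sizes \<open>m \<le> s\<close> of the level sets \<open>{u \<in> C. t \<le> a u}\<close>, and these sizes
  add up to the sum of \<open>a\<close>; by convexity the optimum has all levels but one full or empty. Optimizing
  over \<open>s\<close> gives the bounds. In the extremal case there is a single nontrivial class, all other vertices
  have degree \<open>2\<close> and every edge joins the two kinds of vertices, so \<open>G\<close> is a subdivision.\<close>

subsection \<open>Edge-disjoint paths and cuts\<close>

text \<open>Capping every level size by \<open>s\<close> gives the linear bound
  \<open>(s - 1) (2n - 4s)\<close>, a concave parabola in \<open>s\<close> with peak at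
  \<open>(n + 2) / 4\<close>. This yields the general bound; near the peak there are about four
  levels, whence degrees near 6. The obstacle is rounding: a remainder level of size
  \<open>r\<close> loses \<open>r (s - r)\<close> against the parabola, often more than a short move
  away from the peak costs, so all sizes within distance of order \<open>sqrt n\<close> of the peak
  compete. Among these the exact value is bounded by the quadratics belonging to 3 or 4 full levels.
  For \<open>n = 4k + 2\<close> two sizes tie, which gives two extremal families. The thresholds 8,
  30, 68, 30 are where the comparison becomes strict: for \<open>k\<close> = 7, 29, 67, 29 the class
  sizes 8, 26, 60, 34 have exactly 3, 5, 5, 3 full levels without remainder and reach the same value
  as the intended optimum. The characterization of equality also needs connectivity at least 2 for
  every pair, which is Menger's theorem for two paths.\<close>

definition cut_edges :: "('v, 'e) mgraph \<Rightarrow> 'v set \<Rightarrow> 'e set" where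
  "cut_edges G X = {e \<in> edges G. ends G e \<inter> X \<noteq> {} \<and> \<not> ends G e \<subseteq> X}"

definition joined :: "('v, 'e) mgraph \<Rightarrow> 'e set \<Rightarrow> 'v \<Rightarrow> 'v \<Rightarrow> bool" where
  "joined G F u v \<longleftrightarrow> (u, v) \<in> {(a, b). \<exists>e\<in>F. ends G e = {a, b}}\<^sup>*"

text \<open>Path-free form of \<open>m\<close> edge-disjoint paths: edge sets are easily pushed
  along isomorphisms and subdivisions, and reachability inside \<open>F i\<close> is handled without
  vertex or edge lists. A set \<open>F i\<close> may contain more edges than a path.\<close>

definition packing :: "('v, 'e) mgraph \<Rightarrow> 'v \<Rightarrow> 'v \<Rightarrow> nat \<Rightarrow> bool" where
  "packing G u v m \<longleftrightarrow> (\<exists>F :: nat \<Rightarrow> 'e set.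
     (\<forall>i<m. F i \<subseteq> edges G \<and> joined G (F i) u v) \<and> disjoint_family_on F {..<m})"

lemma joined_refl [simp]: "joined G F u u"
  by (simp add: joined_def)

lemma joined_edge: "e \<in> F \<Longrightarrow> ends G e = {u, v} \<Longrightarrow> joined G F u v"
  unfolding joined_def by (rule r_into_rtrancl) blast

lemma joined_trans: "joined G F u v \<Longrightarrow> joined G F v w \<Longrightarrow> joined G F u w"
  unfolding joined_def by (rule rtrancl_trans)

lemma joined_sym: "joined G F u v \<Longrightarrow> joined G F v u"
proof -
  assume "joined G F u v"
  moreover have "sym {(a, b). \<exists>e\<in>F. ends G e = {a, b}}"
    by (rule symI) (simp add: insert_commute)
  ultimately show ?thesis unfolding joined_def by (blast dest: sym_rtrancl symD)
qed

lemma joined_mono: "joined G F u v \<Longrightarrow> F \<subseteq> F' \<Longrightarrow> joined G F' u v"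
  unfolding joined_def by (erule rev_subsetD) (rule rtrancl_mono, blast)

lemma joined_induct [consumes 1, case_names refl step]:
  assumes "joined G F u v" "P u"
    and "\<And>a b e. joined G F u a \<Longrightarrow> P a \<Longrightarrow> e \<in> F \<Longrightarrow> ends G e = {a, b} \<Longrightarrow> P b"
  shows "P v"
  using assms(1) unfolding joined_def
  by (induction rule: rtrancl_induct) (use assms(2,3) in \<open>auto simp: joined_def\<close>)

lemma joined_crosses:
  assumes "joined G F u v" "F \<subseteq> edges G" "u \<in> X" "v \<notin> X"
  shows "F \<inter> cut_edges G X \<noteq> {}"
proof
  assume *: "F \<inter> cut_edges G X = {}"
  from assms(1) have "v \<in> X"
  proof (induction rule: joined_induct)
    case refl show ?case by fact
  next
    case (step a b e)
    have "e \<notin> cut_edges G X" using * step by blast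
    then show ?case using step assms(2) by (auto simp: cut_edges_def)
  qed
  with assms(4) show False ..
qed

lemma is_path_joined:
  assumes "is_path G u v (xs, es)"
  shows "joined G (set es) u v" "set es \<subseteq> edges G"
proof -
  have len: "length xs = Suc (length es)"
    and e: "\<And>i. i < length es \<Longrightarrow> es ! i \<in> edges G \<and> ends G (es ! i) = {xs ! i, xs ! Suc i}"
    using assms by (auto simp: is_path_def)
  have "i \<le> length es \<Longrightarrow> joined G (set es) (xs ! 0) (xs ! i)" for i
  proof (induction i)
    case (Suc i)
    have "joined G (set es) (xs ! i) (xs ! Suc i)"
      using e[of i] Suc.prems by (intro joined_edge[of "es ! i"]) auto
    with Suc show ?case using joined_trans by (metis Suc_leD)
  qed auto
  from this[of "length es"] show "joined G (set es) u v"
    using assms len by (cases "xs = []") (auto simp: is_path_def hd_conv_nth last_conv_nth)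
  show "set es \<subseteq> edges G" using e by (auto simp: in_set_conv_nth)
qed

lemma is_path_append:
  assumes "is_path G u a (xs, es)" "e \<in> edges G" "ends G e = {a, b}" "b \<notin> set xs" "b \<in> verts G"
  shows "is_path G u b (xs @ [b], es @ [e])"
proof -
  have len: "length xs = Suc (length es)" and xs: "xs \<noteq> []"
    using assms by (auto simp: is_path_def)
  have last: "xs ! length es = a"
    using assms(1) len xs by (auto simp: is_path_def last_conv_nth)
  show ?thesis
    using assms len xs last unfolding is_path_def
    by (auto simp: nth_append less_Suc_eq)
qed

lemma is_path_take:
  assumes "is_path G u a (xs, es)" "i \<le> length es"
  shows "is_path G u (xs ! i) (take (Suc i) xs, take i es)"
proof -
  have len: "length xs = Suc (length es)" and xs: "xs \<noteq> []"
    using assms by (auto simp: is_path_def)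
  have "last (take (Suc i) xs) = xs ! i"
    using len assms(2) xs by (subst last_conv_nth) (auto simp: min_def)
  then show ?thesis
    using assms len xs unfolding is_path_def
    by (auto dest: in_set_takeD)
qed

text \<open>Shortcutting a walk: if the next vertex already lies on the path built so far, the path
  is cut back to that vertex; otherwise it is extended.\<close>

lemma joined_is_path:
  assumes "multigraph G" "F \<subseteq> edges G" "u \<in> verts G" "joined G F u v"
  shows "\<exists>xs es. is_path G u v (xs, es) \<and> set es \<subseteq> F"
  using assms(4)
proof (induction rule: joined_induct)
  case refl
  have "is_path G u u ([u], [])" using assms(3) by (auto simp: is_path_def)
  then show ?case by force
next
  case (step a b e)
  then obtain xs es where p: "is_path G u a (xs, es)" "set es \<subseteq> F" by blast
  show ?case
  proof (cases "b \<in> set xs")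
    case True
    then obtain i where i: "i < length xs" "xs ! i = b" by (auto simp: in_set_conv_nth)
    then have "i \<le> length es" using p by (auto simp: is_path_def)
    from is_path_take[OF p(1) this] i p(2) show ?thesis
      by (metis set_take_subset subset_trans)
  next
    case False
    have "b \<in> verts G" using step assms(1,2) unfolding multigraph_def by blast
    with is_path_append[OF p(1) _ step.hyps(3) False] step.hyps(2) assms(2) p(2) show ?thesis
      by (intro exI[of _ "xs @ [b]"] exI[of _ "es @ [e]"]) auto
  qed
qed

text \<open>\<open>Max\<close> in the definition of local connectivity needs a finite set. As
  \<open>u \<noteq> v\<close>, every path has an edge, and choosing one edge from each path is
  injective.\<close>

lemma finite_card_edge_disjoint_paths:
  assumes "multigraph G" "u \<noteq> v"
  shows "finite {card P |P. edge_disjoint_paths G u v P}"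
proof -
  have "card P \<le> card (edges G)" if P: "edge_disjoint_paths G u v P" for P
  proof -
    have ne: "set (snd p) \<noteq> {} \<and> set (snd p) \<subseteq> edges G" if "p \<in> P" for p
    proof -
      obtain xs es where p: "p = (xs, es)" by force
      have ip: "is_path G u v (xs, es)" using P that p by (auto simp: edge_disjoint_paths_def)
      moreover have "es \<noteq> []"
        using ip assms(2) by (auto simp: is_path_def length_Suc_conv)
      ultimately show ?thesis using is_path_joined(2)[OF ip] p by auto
    qed
    then have "\<forall>p\<in>P. \<exists>e. e \<in> set (snd p)" by (meson ex_in_conv)
    then obtain h where h: "\<And>p. p \<in> P \<Longrightarrow> h p \<in> set (snd p)" by metis
    have "inj_on h P"
    proof (rule inj_onI, rule ccontr)
      fix p q assume pq: "p \<in> P" "q \<in> P" "h p = h q" "p \<noteq> q"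
      then have "set (snd p) \<inter> set (snd q) = {}"
        using P by (simp add: edge_disjoint_paths_def pairwise_def disjnt_def)
      then show False using h[OF pq(1)] h[OF pq(2)] pq(3) by auto
    qed
    moreover have "h ` P \<subseteq> edges G" using ne h by blast
    ultimately show ?thesis
      using assms(1) card_inj_on_le unfolding multigraph_def by blast
  qed
  then have "{card P |P. edge_disjoint_paths G u v P} \<subseteq> {..card (edges G)}" by auto
  then show ?thesis by (rule finite_subset) simp
qed

lemma packing_mono: "packing G u v m \<Longrightarrow> m' \<le> m \<Longrightarrow> packing G u v m'"
  unfolding packing_def disjoint_family_on_def
  by (erule exE) (rule_tac x = F in exI, simp)

lemma edge_disjoint_paths_packing:
  assumes "edge_disjoint_paths G u v P"
  shows "packing G u v (card P)"
proof -
  have fin: "finite P" using assms by (auto simp: edge_disjoint_paths_def)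
  then obtain h where h: "bij_betw h {..<card P} P"
    using ex_bij_betw_nat_finite atLeast0LessThan by metis
  define F where "F i = set (snd (h i))" for i
  have "F i \<subseteq> edges G \<and> joined G (F i) u v" if "i < card P" for i
  proof -
    have "h i \<in> P" using h that by (auto simp: bij_betw_def)
    then have "is_path G u v (fst (h i), snd (h i))"
      using assms by (auto simp: edge_disjoint_paths_def)
    from is_path_joined[OF this] show ?thesis by (simp add: F_def)
  qed
  moreover have "disjoint_family_on F {..<card P}"
    unfolding disjoint_family_on_def
  proof (intro ballI impI)
    fix i j assume "i \<in> {..<card P}" "j \<in> {..<card P}" "i \<noteq> j"
    then have "h i \<in> P" "h j \<in> P" "h i \<noteq> h j"
      using h by (auto simp: bij_betw_def inj_on_def)
    then show "F i \<inter> F j = {}"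
      using assms unfolding edge_disjoint_paths_def pairwise_def F_def disjnt_def by blast
  qed
  ultimately show ?thesis unfolding packing_def by blast
qed

lemma packing_edge_disjoint_paths:
  assumes "multigraph G" "u \<in> verts G" "u \<noteq> v" "packing G u v m"
  obtains P where "edge_disjoint_paths G u v P" "card P = m"
proof -
  obtain F :: "nat \<Rightarrow> 'b set" where F: "\<And>i. i < m \<Longrightarrow> F i \<subseteq> edges G \<and> joined G (F i) u v"
    and dis: "disjoint_family_on F {..<m}"
    using assms(4) unfolding packing_def by blast
  have "\<forall>i\<in>{..<m}. \<exists>p. is_path G u v p \<and> set (snd p) \<subseteq> F i"
    using joined_is_path[OF assms(1) _ assms(2)] F by (metis lessThan_iff snd_conv)
  then obtain p where p: "\<And>i. i < m \<Longrightarrow> is_path G u v (p i) \<and> set (snd (p i)) \<subseteq> F i"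
    by (metis lessThan_iff)
  have ne: "set (snd (p i)) \<noteq> {}" if "i < m" for i
    using p[OF that] assms(3)
    by (cases "p i") (auto simp: is_path_def length_Suc_conv)
  have d: "set (snd (p i)) \<inter> set (snd (p j)) = {}" if "i < m" "j < m" "i \<noteq> j" for i j
  proof -
    have "F i \<inter> F j = {}" using that dis by (simp add: disjoint_family_on_def)
    then show ?thesis using p[OF that(1)] p[OF that(2)] by blast
  qed
  have inj: "inj_on p {..<m}"
  proof (rule inj_onI, rule ccontr)
    fix i j assume ij: "i \<in> {..<m}" "j \<in> {..<m}" "p i = p j" "i \<noteq> j"
    then show False using d[of i j] ne[of i] by simp
  qed
  have "edge_disjoint_paths G u v (p ` {..<m})"
    unfolding edge_disjoint_paths_def
  proof (intro conjI ballI)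
    show "pairwise (\<lambda>p q. disjnt (set (snd p)) (set (snd q))) (p ` {..<m})"
    proof (rule pairwiseI)
      fix x y assume "x \<in> p ` {..<m}" "y \<in> p ` {..<m}" "x \<noteq> y"
      then obtain i j where "i < m" "j < m" "i \<noteq> j" "x = p i" "y = p j" by blast
      then show "disjnt (set (snd x)) (set (snd y))" using d by (simp add: disjnt_def)
    qed
  qed (use p in auto)
  with inj show ?thesis using that by (metis card_image card_lessThan)
qed

text \<open>Both translations between paths and packings meet here; afterwards local connectivity is
  handled only through packings and cuts.\<close>

lemma le_local_edge_connectivity_iff:
  assumes "multigraph G" "u \<in> verts G" "u \<noteq> v"
  shows "m \<le> local_edge_connectivity G u v \<longleftrightarrow> packing G u v m"
proof -
  let ?S = "{card P |P. edge_disjoint_paths G u v P}"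
  have fin: "finite ?S" by (rule finite_card_edge_disjoint_paths[OF assms(1,3)])
  have "edge_disjoint_paths G u v {}" by (auto simp: edge_disjoint_paths_def)
  then have ne: "?S \<noteq> {}" by blast
  show ?thesis
  proof
    assume "m \<le> local_edge_connectivity G u v"
    moreover have "local_edge_connectivity G u v \<in> ?S"
      unfolding local_edge_connectivity_def using fin ne by (rule Max_in)
    ultimately show "packing G u v m"
      using edge_disjoint_paths_packing packing_mono by force
  next
    assume "packing G u v m"
    then obtain P where "edge_disjoint_paths G u v P" "card P = m"
      using packing_edge_disjoint_paths[OF assms] by blast
    then have "m \<in> ?S" by blast
    then show "m \<le> local_edge_connectivity G u v"
      unfolding local_edge_connectivity_def using fin by (rule Max_ge[rotated])
  qed
qed

text \<open>The easy half of Menger's theorem: each of the disjoint sets must spend an edge of its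
  own on crossing \<open>X\<close>.\<close>

lemma packing_le_card_cut_edges:
  assumes "multigraph G" "packing G u v m" "(u \<in> X) \<noteq> (v \<in> X)"
  shows "m \<le> card (cut_edges G X)"
proof -
  obtain F where F: "\<And>i. i < m \<Longrightarrow> F i \<subseteq> edges G \<and> joined G (F i) u v"
    and dis: "disjoint_family_on F {..<m}"
    using assms(2) unfolding packing_def by blast
  have "F i \<inter> cut_edges G X \<noteq> {}" if "i < m" for i
  proof -
    have F: "F i \<subseteq> edges G" "joined G (F i) u v" "joined G (F i) v u"
      using F[OF that] joined_sym by auto
    show ?thesis
      using joined_crosses[OF F(2,1), of X] joined_crosses[OF F(3,1), of X] assms(3) by blast
  qed
  then have "\<forall>i\<in>{..<m}. \<exists>e. e \<in> F i \<inter> cut_edges G X" by blast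
  then obtain h where h: "\<And>i. i < m \<Longrightarrow> h i \<in> F i \<inter> cut_edges G X" by (metis lessThan_iff)
  have "inj_on h {..<m}"
  proof (rule inj_onI, rule ccontr)
    fix i j assume ij: "i \<in> {..<m}" "j \<in> {..<m}" "h i = h j" "i \<noteq> j"
    then have "F i \<inter> F j = {}" using dis by (simp add: disjoint_family_on_def)
    then show False using h[of i] h[of j] ij by auto
  qed
  moreover have "h ` {..<m} \<subseteq> cut_edges G X" using h by blast
  moreover have "finite (cut_edges G X)"
    using assms(1) by (auto simp: multigraph_def cut_edges_def)
  ultimately show ?thesis using card_inj_on_le[of h "{..<m}"] by simp
qed

lemma local_edge_connectivity_le_card_cut_edges:
  assumes "multigraph G" "u \<in> verts G" "(u \<in> X) \<noteq> (v \<in> X)"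
  shows "local_edge_connectivity G u v \<le> card (cut_edges G X)"
proof -
  have "u \<noteq> v" using assms(3) by auto
  from le_local_edge_connectivity_iff[OF assms(1,2) this, of "local_edge_connectivity G u v"]
  show ?thesis using packing_le_card_cut_edges[OF assms(1) _ assms(3)] by simp
qed

lemma cut_edges_singleton:
  assumes "multigraph G"
  shows "cut_edges G {v} = {e \<in> edges G. v \<in> ends G e}"
proof -
  have "\<not> ends G e \<subseteq> {v}" if "e \<in> edges G" for e
  proof
    assume "ends G e \<subseteq> {v}"
    then have "card (ends G e) \<le> card {v}" by (intro card_mono) auto
    then show False using assms that by (auto simp: multigraph_def)
  qed
  then show ?thesis unfolding cut_edges_def by blast
qed

lemma local_edge_connectivity_le_degree:
  assumes "multigraph G" "u \<in> verts G" "v \<in> verts G" "u \<noteq> v"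
  shows "local_edge_connectivity G u v \<le> min (degree G u) (degree G v)"
  using local_edge_connectivity_le_card_cut_edges[OF assms(1,2), of "{u}" v]
    local_edge_connectivity_le_card_cut_edges[OF assms(1,2), of "{v}" v] assms
  by (simp add: cut_edges_singleton degree_def)

text \<open>Reachability through \<open>F\<close> is closed under steps along \<open>F\<close>. This
  is how failed reachability is turned into a cut.\<close>

lemma cut_edges_joined_set:
  assumes "multigraph G" "F \<subseteq> edges G"
  shows "F \<inter> cut_edges G {x \<in> verts G. joined G F u x} = {}" (is "F \<inter> cut_edges G ?X = {}")
proof (rule ccontr)
  assume "F \<inter> cut_edges G ?X \<noteq> {}"
  then obtain e where e: "e \<in> F" "e \<in> cut_edges G ?X" by blast
  have c: "card (ends G e) = 2" "ends G e \<subseteq> verts G"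
    using e assms by (auto simp: multigraph_def)
  obtain a where a: "a \<in> ends G e" "a \<in> ?X" using e by (auto simp: cut_edges_def)
  obtain b where b: "b \<in> ends G e" "b \<notin> ?X" using e by (auto simp: cut_edges_def)
  have "ends G e = {a, b}" using c(1) a b by (auto simp: card_2_iff)
  then have "joined G F a b" using e by (intro joined_edge) auto
  moreover have "joined G F u a" using a by simp
  ultimately have "joined G F u b" by (rule joined_trans[rotated])
  then show False using b c by auto
qed

section \<open>Global edge-connectivity in terms of cuts\<close>

lemma not_connected_iff_cut:
  assumes "multigraph G" "verts G \<noteq> {}"
  shows "\<not> connected_graph (delete_edges G S) \<longleftrightarrow>
    (\<exists>X. X \<subset> verts G \<and> X \<noteq> {} \<and> cut_edges G X \<subseteq> S)"
proof -
  let ?D = "delete_edges G S"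
  have D: "verts ?D = verts G" "edges ?D = edges G - S" "ends ?D = ends G"
    by (auto simp: delete_edges_def)
  have mD: "multigraph ?D" using assms(1) by (auto simp: multigraph_def D)
  have jD: "joined ?D F = joined G F" for F by (auto simp: joined_def D fun_eq_iff)
  show ?thesis
  proof
    assume "\<not> connected_graph ?D"
    then obtain u v where uv: "u \<in> verts G" "v \<in> verts G" "\<And>p. \<not> is_path ?D u v p"
      using assms(2) by (auto simp: connected_graph_def D)
    have nj: "\<not> joined G (edges G - S) u v"
      using joined_is_path[OF mD, of "edges G - S" u v] uv by (auto simp: D jD)
    define X where "X = {x \<in> verts G. joined G (edges G - S) u x}"
    have "(edges G - S) \<inter> cut_edges G X = {}"
      unfolding X_def using assms(1) by (rule cut_edges_joined_set) blast
    then have "cut_edges G X \<subseteq> S" by (auto simp: cut_edges_def)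
    moreover have "u \<in> X" "v \<notin> X" using uv nj by (auto simp: X_def)
    ultimately show "\<exists>X. X \<subset> verts G \<and> X \<noteq> {} \<and> cut_edges G X \<subseteq> S"
      using uv by (intro exI[of _ X]) (auto simp: X_def)
  next
    assume "\<exists>X. X \<subset> verts G \<and> X \<noteq> {} \<and> cut_edges G X \<subseteq> S"
    then obtain X u v where X: "X \<subset> verts G" "u \<in> X" "v \<in> verts G" "v \<notin> X" "cut_edges G X \<subseteq> S"
      by blast
    have "\<not> is_path ?D u v (xs, es)" for xs es
    proof
      assume "is_path ?D u v (xs, es)"
      from is_path_joined[OF this] have "joined G (set es) u v" "set es \<subseteq> edges G - S"
        by (auto simp: jD D)
      then show False using joined_crosses[of G "set es" u v X] X by blast
    qed
    then have "\<not> (\<exists>p. is_path ?D u v p)" by simp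
    moreover have "u \<in> verts G" using X(1,2) by blast
    ultimately show "\<not> connected_graph ?D"
      using X(3) unfolding connected_graph_def D by blast
  qed
qed

lemma edge_connectivity_le:
  assumes "multigraph G" "X \<subset> verts G" "X \<noteq> {}"
  shows "edge_connectivity G \<le> card (cut_edges G X)"
proof -
  have "verts G \<noteq> {}" using assms by blast
  then have "\<not> connected_graph (delete_edges G (cut_edges G X))"
    using not_connected_iff_cut[OF assms(1), of "cut_edges G X"] assms by auto
  moreover have "cut_edges G X \<subseteq> edges G" by (auto simp: cut_edges_def)
  ultimately show ?thesis unfolding edge_connectivity_def by (intro Least_le) blast
qed

text \<open>The \<open>LEAST\<close> in \<open>edge_connectivity\<close> needs a nonempty range:
  with two vertices, the star of any \<open>v\<close> disconnects the graph. A least disconnecting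
  set then contains a cut.\<close>

lemma edge_connectivity_attained:
  assumes "multigraph G" "graph_order G \<ge> 2"
  obtains X where "X \<subset> verts G" "X \<noteq> {}" "card (cut_edges G X) \<le> edge_connectivity G"
proof -
  let ?P = "\<lambda>m. \<exists>S\<subseteq>edges G. card S = m \<and> \<not> connected_graph (delete_edges G S)"
  obtain v where v: "v \<in> verts G"
    using assms(2) by (fastforce simp: graph_order_def)
  have "{v} \<noteq> verts G" using assms(2) unfolding graph_order_def
    by (metis card.empty card_insert_disjoint empty_iff finite.emptyI One_nat_def Suc_1 Suc_n_not_le_n)
  then have "\<not> connected_graph (delete_edges G (cut_edges G {v}))"
    using not_connected_iff_cut[OF assms(1), of "cut_edges G {v}"] v by auto
  then have "?P (card (cut_edges G {v}))"
    by (intro exI[of _ "cut_edges G {v}"]) (simp add: cut_edges_def)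
  then have "?P (edge_connectivity G)" unfolding edge_connectivity_def by (rule LeastI)
  then obtain S where S: "S \<subseteq> edges G" "card S = edge_connectivity G"
    "\<not> connected_graph (delete_edges G S)" by blast
  then obtain X where X: "X \<subset> verts G" "X \<noteq> {}" "cut_edges G X \<subseteq> S"
    using not_connected_iff_cut[OF assms(1), of S] v by auto
  have "finite S" using S(1) assms(1) finite_subset by (auto simp: multigraph_def)
  with X S have "card (cut_edges G X) \<le> edge_connectivity G" by (metis card_mono)
  with X that show ?thesis by blast
qed

text \<open>Minimality gives \<open>G\<close> without \<open>e\<close> a cut with at most one edge.
  In \<open>G\<close> the same \<open>X\<close> has at least two cut edges, so \<open>e\<close> must
  be the one that returns.\<close>

lemma minimally_2_edge_connected_cuts:
  assumes "multigraph G" "minimally_2_edge_connected G"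
  shows "\<And>X. X \<subset> verts G \<Longrightarrow> X \<noteq> {} \<Longrightarrow> 2 \<le> card (cut_edges G X)"
    and "\<And>e. e \<in> edges G \<Longrightarrow> \<exists>X\<subseteq>verts G. e \<in> cut_edges G X \<and> card (cut_edges G X) \<le> 2"
proof -
  show c2: "2 \<le> card (cut_edges G X)" if "X \<subset> verts G" "X \<noteq> {}" for X
    using edge_connectivity_le[OF assms(1) that] assms(2) by (auto simp: minimally_2_edge_connected_def)
  fix e assume e: "e \<in> edges G"
  let ?D = "delete_edges G {e}"
  have mD: "multigraph ?D" using assms(1) by (auto simp: multigraph_def delete_edges_def)
  have "graph_order ?D \<ge> 2" using assms(2)
    by (auto simp: minimally_2_edge_connected_def graph_order_def delete_edges_def)
  with mD obtain X where X: "X \<subset> verts ?D" "X \<noteq> {}" "card (cut_edges ?D X) \<le> edge_connectivity ?D"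
    by (rule edge_connectivity_attained)
  have "edge_connectivity ?D < 2" using assms(2) e by (auto simp: minimally_2_edge_connected_def)
  with X have lt: "card (cut_edges ?D X) < 2" by simp
  have X': "X \<subset> verts G" using X by (simp add: delete_edges_def)
  have eq: "cut_edges ?D X = cut_edges G X - {e}" by (auto simp: cut_edges_def delete_edges_def)
  have fin: "finite (cut_edges G X)" using assms(1) by (auto simp: multigraph_def cut_edges_def)
  have "e \<in> cut_edges G X" using c2[OF X' X(2)] lt eq by (metis Diff_insert0 Diff_empty not_less)
  moreover have "card (cut_edges G X) \<le> 2" using lt eq fin by (simp add: card_Diff_singleton_if split: if_splits)
  ultimately show "\<exists>X\<subseteq>verts G. e \<in> cut_edges G X \<and> card (cut_edges G X) \<le> 2"
    using X' by blast
qed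

subsection \<open>Sums of pairwise minima\<close>

text \<open>The largest possible value of the sum of \<open>n (n - 1)\<close> over a family of numbers between \<open>0\<close> and
  \<open>s\<close> with total \<open>M\<close>: as many as possible equal \<open>s\<close>, and one takes the remainder.\<close>

definition fill :: "int \<Rightarrow> int \<Rightarrow> int" where
  "fill s M = (M div s) * (s * (s - 1)) + (M mod s) * (M mod s - 1)"

lemma fill_eq:
  assumes "0 \<le> r" "r < s"
  shows "fill s (q * s + r) = q * (s * (s - 1)) + r * (r - 1)"
  using assms by (simp add: fill_def)

text \<open>\<open>fill s M\<close> is the minimum of these quadratics over all integers
  \<open>q\<close>, attained at \<open>q = M div s\<close>: the difference is
  \<open>s d (s (1 + d) - 2 r)\<close> with \<open>d = q - M div s\<close>, and \<open>d\<close> and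
  the bracket never have opposite signs because \<open>0 \<le> r < s\<close>. Fixing
  \<open>q\<close> removes \<open>div\<close> and \<open>mod\<close> from the optimization.\<close>

lemma fill_le:
  assumes "s > 0"
  shows "fill s M \<le> q * (s * (s - 1)) + (M - q * s) * (M - q * s - 1)"
proof -
  define d r where "d = q - M div s" and "r = M mod s"
  have r: "0 \<le> r" "r < s" using assms by (auto simp: r_def)
  have M: "M = (q - d) * s + r" unfolding d_def r_def by simp
  have "0 \<le> d * (s * (1 + d) - 2 * r)"
  proof -
    consider "d \<ge> 1" | "d = 0" | "d \<le> -1" by linarith
    then show ?thesis
    proof cases
      case 1
      then have "s * 2 \<le> s * (1 + d)" using assms by (intro mult_left_mono) auto
      then have "0 \<le> s * (1 + d) - 2 * r" using r by linarith
      then show ?thesis using 1 by (intro mult_nonneg_nonneg) auto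
    next
      case 3
      then have "s * (1 + d) \<le> 0" using assms by (intro mult_nonneg_nonpos) auto
      then have "s * (1 + d) - 2 * r \<le> 0" using r by linarith
      then show ?thesis using 3 by (intro mult_nonpos_nonpos) auto
    qed simp
  qed
  then have "0 \<le> s * (d * (s * (1 + d) - 2 * r))" using assms by (rule mult_nonneg_nonneg[OF less_imp_le, rotated])
  moreover have "q * (s * (s - 1)) + (M - q * s) * (M - q * s - 1) - fill s M = s * (d * (s * (1 + d) - 2 * r))"
    unfolding M fill_eq[OF r] by (simp add: algebra_simps)
  ultimately show ?thesis by linarith
qed

text \<open>Pouring \<open>m\<close> into the partly filled number \<open>r\<close>: without
  overflow the gain is \<open>2 r m\<close>, with overflow it is
  \<open>2 (s - r) (s - m)\<close>.\<close>

lemma fill_add: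
  assumes "0 \<le> m" "m \<le> s" "s > 0"
  shows "fill s M + m * (m - 1) \<le> fill s (M + m)"
proof -
  define q r where "q = M div s" and "r = M mod s"
  have r: "0 \<le> r" "r < s" using assms by (auto simp: r_def)
  have M: "M = q * s + r" unfolding q_def r_def by simp
  have rm: "0 \<le> r * m" using r assms by simp
  show ?thesis
  proof (cases "r + m < s")
    case True
    have "fill s (M + m) = q * (s * (s - 1)) + (r + m) * (r + m - 1)"
      using fill_eq[of "r + m" s q] True r assms M by (simp add: add.assoc)
    then show ?thesis unfolding M fill_eq[OF r] using rm by (simp add: algebra_simps)
  next
    case False
    have "fill s (M + m) = (q + 1) * (s * (s - 1)) + (r + m - s) * (r + m - s - 1)"
      using fill_eq[of "r + m - s" s "q + 1"] False r assms M by (simp add: algebra_simps)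
    then have "fill s (M + m) - (fill s M + m * (m - 1)) = 2 * ((s - r) * (s - m))"
      unfolding M fill_eq[OF r] by (simp add: algebra_simps)
    moreover have "0 \<le> (s - r) * (s - m)" using r assms by simp
    ultimately show ?thesis by linarith
  qed
qed

lemma fill_mono:
  assumes "s > 0" "M \<le> M'"
  shows "fill s M \<le> fill s M'"
  using assms(2)
proof (induction rule: int_ge_induct)
  case (step i)
  then show ?case using fill_add[of 1 s i] assms(1) by simp
qed simp

lemma sum_choose_2_le_fill:
  fixes n :: "'j \<Rightarrow> int"
  assumes "finite J" "\<And>j. j \<in> J \<Longrightarrow> 0 \<le> n j \<and> n j \<le> s" "s > 0"
  shows "(\<Sum>j\<in>J. n j * (n j - 1)) \<le> fill s (\<Sum>j\<in>J. n j)"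
  using assms(1,2)
proof (induction rule: finite_induct)
  case empty
  then show ?case using assms(3) by (simp add: fill_def)
next
  case (insert j J)
  then have "(\<Sum>j\<in>J. n j * (n j - 1)) \<le> fill s (\<Sum>j\<in>J. n j)" by simp
  moreover have "fill s (\<Sum>j\<in>J. n j) + n j * (n j - 1) \<le> fill s ((\<Sum>j\<in>J. n j) + n j)"
    using insert.prems assms(3) by (intro fill_add) auto
  ultimately show ?case using insert.hyps by (simp add: add.commute)
qed

section \<open>Pairwise minima as sums over level sets\<close>

abbreviation pairs :: "'v set \<Rightarrow> 'v set set" where
  "pairs C \<equiv> {p. p \<subseteq> C \<and> card p = 2}"

definition pair_min :: "'v set \<Rightarrow> ('v \<Rightarrow> nat) \<Rightarrow> nat" where
  "pair_min C a = (\<Sum>p\<in>pairs C. Min (a ` p))"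

definition level :: "'v set \<Rightarrow> ('v \<Rightarrow> nat) \<Rightarrow> nat \<Rightarrow> nat" where
  "level C a t = card {u \<in> C. t \<le> a u}"

lemma finite_pairs: "finite C \<Longrightarrow> finite (pairs C)"
  by simp

lemma sum_eq_sum_level:
  assumes "finite C" "\<And>u. u \<in> C \<Longrightarrow> a u \<le> T"
  shows "(\<Sum>u\<in>C. a u) = (\<Sum>t=1..T. level C a t)"
proof -
  have "(\<Sum>u\<in>C. a u) = (\<Sum>u\<in>C. \<Sum>t=1..T. if t \<le> a u then 1 else 0)"
  proof (rule sum.cong)
    fix u assume "u \<in> C"
    then have "{t \<in> {1..T}. t \<le> a u} = {1..a u}" using assms(2) by fastforce
    then show "a u = (\<Sum>t=1..T. if t \<le> a u then 1 else 0)" by (simp add: sum.If_cases Int_def)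
  qed simp
  also have "\<dots> = (\<Sum>t=1..T. \<Sum>u\<in>C. if t \<le> a u then 1 else 0)" by (rule sum.swap)
  also have "\<dots> = (\<Sum>t=1..T. level C a t)"
    using assms(1) by (simp add: level_def sum.If_cases Int_def)
  finally show ?thesis .
qed

text \<open>A pair has minimum at least \<open>t\<close> exactly if it lies inside the level set at
  \<open>t\<close>, so each minimum counts the levels that contain the pair.\<close>

lemma pair_min_eq_sum_level:
  assumes "finite C" "\<And>u. u \<in> C \<Longrightarrow> a u \<le> T"
  shows "pair_min C a = (\<Sum>t=1..T. level C a t choose 2)"
proof -
  have "pair_min C a = (\<Sum>p\<in>pairs C. \<Sum>t=1..T. if p \<subseteq> {u \<in> C. t \<le> a u} then 1 else 0)"
    unfolding pair_min_def
  proof (rule sum.cong)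
    fix p assume p: "p \<in> pairs C"
    then have fin: "finite p" "p \<noteq> {}" by (auto intro: card_ge_0_finite)
    have "Min (a ` p) \<in> a ` p" using fin by (intro Min_in) auto
    then have "Min (a ` p) \<le> T" using p assms(2) by auto
    moreover have iff: "t \<le> Min (a ` p) \<longleftrightarrow> p \<subseteq> {u \<in> C. t \<le> a u}" for t
      using p fin by auto
    ultimately have "{t \<in> {1..T}. p \<subseteq> {u \<in> C. t \<le> a u}} = {1..Min (a ` p)}"
      by (simp add: set_eq_iff del: Min_ge_iff flip: iff) auto
    then show "Min (a ` p) = (\<Sum>t=1..T. if p \<subseteq> {u \<in> C. t \<le> a u} then 1 else 0)"
      by (simp add: sum.If_cases Int_def)
  qed simp
  also have "\<dots> = (\<Sum>t=1..T. \<Sum>p\<in>pairs C. if p \<subseteq> {u \<in> C. t \<le> a u} then 1 else 0)" by (rule sum.swap)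
  also have "\<dots> = (\<Sum>t=1..T. level C a t choose 2)"
  proof (rule sum.cong)
    fix t
    have "(\<Sum>p\<in>pairs C. if p \<subseteq> {u \<in> C. t \<le> a u} then 1 else 0)
        = card (pairs C \<inter> {p. p \<subseteq> {u \<in> C. t \<le> a u}})"
      using assms(1) by (simp add: sum.If_cases finite_pairs)
    also have "pairs C \<inter> {p. p \<subseteq> {u \<in> C. t \<le> a u}} = pairs {u \<in> C. t \<le> a u}" by blast
    also have "card \<dots> = level C a t choose 2"
      unfolding level_def using assms(1) by (intro n_subsets) simp
    finally show "(\<Sum>p\<in>pairs C. if p \<subseteq> {u \<in> C. t \<le> a u} then 1 else 0) = level C a t choose 2" .
  qed simp
  finally show ?thesis .
qed

lemma two_times_choose_2: "2 * int (n choose 2) = int n * (int n - 1)"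
proof (induction n)
  case (Suc n)
  have "Suc n choose 2 = n + (n choose 2)"
    by (simp add: numeral_2_eq_2)
  with Suc show ?case by (simp add: algebra_simps)
qed simp

lemma level_le: "finite C \<Longrightarrow> level C a t \<le> card C"
  unfolding level_def by (rule card_mono) auto

text \<open>The level sizes of all classes are pooled into one family indexed by class and level, so
  the bounds do not depend on how the excess is distributed among the classes. The first bound can
  be attained but is irregular in \<open>s\<close>; the second is smooth.\<close>

lemma sum_pair_min_bounds:
  assumes "finite \<C>" "\<And>C. C \<in> \<C> \<Longrightarrow> finite C \<and> card C \<le> s" "s > 0"
  shows "2 * int (\<Sum>C\<in>\<C>. pair_min C a) \<le> fill (int s) (int (\<Sum>C\<in>\<C>. \<Sum>u\<in>C. a u))"
    and "2 * int (\<Sum>C\<in>\<C>. pair_min C a) \<le> (int s - 1) * int (\<Sum>C\<in>\<C>. \<Sum>u\<in>C. a u)"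
proof -
  define T where "T = Max (insert 0 (a ` \<Union>\<C>))"
  have T: "a u \<le> T" if "u \<in> C" "C \<in> \<C>" for u C
    unfolding T_def using that assms(1,2) by (intro Max_ge) auto
  let ?n = "\<lambda>(C, t). int (level C a t)"
  have n: "0 \<le> ?n j \<and> ?n j \<le> int s" if jj: "j \<in> \<C> \<times> {1..T}" for j
  proof -
    obtain C t where j: "j = (C, t)" "C \<in> \<C>" using jj by blast
    then have "level C a t \<le> s" using assms(2) level_le le_trans by blast
    then show ?thesis using j by simp
  qed
  have W: "2 * int (\<Sum>C\<in>\<C>. pair_min C a) = (\<Sum>j\<in>\<C> \<times> {1..T}. ?n j * (?n j - 1))"
  proof -
    have "pair_min C a = (\<Sum>t=1..T. level C a t choose 2)" if "C \<in> \<C>" for C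
      using pair_min_eq_sum_level[of C a T] assms(2) T that by blast
    then have "2 * int (\<Sum>C\<in>\<C>. pair_min C a) = 2 * int (\<Sum>C\<in>\<C>. \<Sum>t=1..T. level C a t choose 2)"
      by simp
    also have "\<dots> = (\<Sum>C\<in>\<C>. \<Sum>t=1..T. int (level C a t) * (int (level C a t) - 1))"
      by (simp only: of_nat_sum sum_distrib_left two_times_choose_2)
    finally show ?thesis by (simp only: sum.cartesian_product case_prod_unfold)
  qed
  have M: "int (\<Sum>C\<in>\<C>. \<Sum>u\<in>C. a u) = (\<Sum>j\<in>\<C> \<times> {1..T}. ?n j)"
  proof -
    have "(\<Sum>C\<in>\<C>. \<Sum>u\<in>C. a u) = (\<Sum>C\<in>\<C>. \<Sum>t=1..T. level C a t)"
      using assms(2) T by (intro sum.cong refl sum_eq_sum_level) auto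
    then show ?thesis by (simp add: sum.cartesian_product case_prod_unfold)
  qed
  show "2 * int (\<Sum>C\<in>\<C>. pair_min C a) \<le> fill (int s) (int (\<Sum>C\<in>\<C>. \<Sum>u\<in>C. a u))"
    unfolding W M using n assms(1,3) by (intro sum_choose_2_le_fill) auto
  have "(\<Sum>j\<in>\<C> \<times> {1..T}. ?n j * (?n j - 1)) \<le> (\<Sum>j\<in>\<C> \<times> {1..T}. (int s - 1) * ?n j)"
  proof (rule sum_mono)
    fix j assume "j \<in> \<C> \<times> {1..T}"
    from n[OF this] have "?n j * (?n j - 1) \<le> ?n j * (int s - 1)" by (intro mult_left_mono) auto
    then show "?n j * (?n j - 1) \<le> (int s - 1) * ?n j" by (simp only: mult.commute)
  qed
  then show "2 * int (\<Sum>C\<in>\<C>. pair_min C a) \<le> (int s - 1) * int (\<Sum>C\<in>\<C>. \<Sum>u\<in>C. a u)"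
    unfolding W M by (simp only: sum_distrib_left)
qed

text \<open>If \<open>a u \<ge> a v + 2\<close>, moving a unit from the level \<open>a u\<close> to the level \<open>a v + 1\<close> keeps the total
  and increases the sum of the binomials.\<close>

lemma pair_min_eq_fill_imp:
  assumes "finite C" and eq: "2 * int (pair_min C a) = fill (int (card C)) (int (\<Sum>u\<in>C. a u))"
    and uv: "u \<in> C" "v \<in> C"
  shows "a u \<le> a v + 1"
proof (rule ccontr)
  assume "\<not> a u \<le> a v + 1"
  define T where "T = Max (a ` C)"
  have T: "a w \<le> T" if "w \<in> C" for w unfolding T_def using that assms(1) by simp
  define x y where "x = a u" and "y = a v + 1"
  have xy: "y < x" "1 \<le> y" "x \<le> T" using \<open>\<not> _\<close> T uv by (auto simp: x_def y_def)
  define n where "n t = int (level C a t)" for t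
  have ny: "n y < int (card C)"
  proof -
    have "v \<notin> {w \<in> C. y \<le> a w}" by (simp add: y_def)
    then have "{w \<in> C. y \<le> a w} \<subset> C" using uv(2) by blast
    then show ?thesis unfolding n_def level_def using assms(1) by (simp add: psubset_card_mono)
  qed
  have nx: "1 \<le> n x"
  proof -
    have "0 < card {w \<in> C. x \<le> a w}" using uv(1) assms(1) by (auto simp: card_gt_0_iff x_def)
    then show ?thesis by (simp add: n_def level_def)
  qed
  have nxy: "n x \<le> n y"
    unfolding n_def level_def using xy assms(1) by (auto intro!: card_mono)
  have nle: "0 \<le> n t" "n t \<le> int (card C)" for t using level_le[OF assms(1)] by (auto simp: n_def)
  \<comment> \<open>\<open>n'\<close> is just a family of numbers, not the levels of another
    function: \<open>sum_choose_2_le_fill\<close> only asks for values between 0 and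
    \<open>card C\<close>. These limits hold since \<open>v\<close> is missing from level
    \<open>y\<close> and \<open>u\<close> is present at level \<open>x\<close>.\<close>
  define n' where "n' t = (if t = x then n x - 1 else if t = y then n y + 1 else n t)" for t
  have split: "(\<Sum>t=1..T. f t) = f x + f y + (\<Sum>t\<in>{1..T}-{x}-{y}. f t)" for f :: "nat \<Rightarrow> int"
  proof -
    have "(\<Sum>t=1..T. f t) = f x + (\<Sum>t\<in>{1..T}-{x}. f t)"
      using xy by (intro sum.remove) auto
    also have "(\<Sum>t\<in>{1..T}-{x}. f t) = f y + (\<Sum>t\<in>{1..T}-{x}-{y}. f t)"
      using xy by (intro sum.remove) auto
    finally show ?thesis by simp
  qed
  have rest: "(\<Sum>t\<in>{1..T}-{x}-{y}. f (n' t)) = (\<Sum>t\<in>{1..T}-{x}-{y}. f (n t))" for f :: "int \<Rightarrow> int"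
    by (rule sum.cong) (auto simp: n'_def)
  have n'xy: "n' x = n x - 1" "n' y = n y + 1" using xy by (auto simp: n'_def)
  have "(\<Sum>t=1..T. n' t) = (\<Sum>t=1..T. n t)"
    unfolding split rest[of "\<lambda>z. z"] n'xy by simp
  also have "\<dots> = int (\<Sum>u\<in>C. a u)"
    using sum_eq_sum_level[of C a T] assms(1) T by (simp add: n_def)
  finally have M: "(\<Sum>t=1..T. n' t) = int (\<Sum>u\<in>C. a u)" .
  have "2 * int (pair_min C a) = (\<Sum>t=1..T. n t * (n t - 1))"
    using pair_min_eq_sum_level[of C a T] assms(1) T
    by (simp only: n_def of_nat_sum sum_distrib_left two_times_choose_2)
  \<comment> \<open>The move changes the sum by \<open>2 (n y - n x + 1)\<close>, which is positive
    since level sets shrink as the level grows.\<close>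
  also have "\<dots> < (\<Sum>t=1..T. n' t * (n' t - 1))"
    unfolding split rest[of "\<lambda>z. z * (z - 1)"] n'xy using nxy by (simp add: algebra_simps)
  also have "\<dots> \<le> fill (int (card C)) (\<Sum>t=1..T. n' t)"
  proof (rule sum_choose_2_le_fill)
    show "0 \<le> n' t \<and> n' t \<le> int (card C)" for t
      using nle[of t] nx ny nle(2)[of x] by (auto simp: n'_def)
    show "0 < int (card C)" using uv(1) assms(1) by (auto simp: card_gt_0_iff)
  qed simp
  finally show False using eq M by simp
qed

text \<open>With minimum \<open>q\<close>, the levels up to \<open>q\<close> are full, level
  \<open>q + 1\<close> misses a vertex attaining the minimum, and all higher levels are empty: the
  shape that \<open>fill\<close> describes.\<close>

lemma pair_min_nearly_regular:
  assumes "finite C" "C \<noteq> {}" "\<And>u v. u \<in> C \<Longrightarrow> v \<in> C \<Longrightarrow> a u \<le> a v + 1"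
  shows "2 * int (pair_min C a) = fill (int (card C)) (int (\<Sum>u\<in>C. a u))"
proof -
  define q where "q = Min (a ` C)"
  have q: "q \<le> a u" "a u \<le> Suc q" if "u \<in> C" for u
  proof -
    show "q \<le> a u" unfolding q_def using that assms(1) by simp
    have "q \<in> a ` C" unfolding q_def using assms(1,2) by (intro Min_in) auto
    then show "a u \<le> Suc q" using assms(3) that by auto
  qed
  define r where "r = level C a (Suc q)"
  have lev: "level C a t = card C" if "t \<in> {1..q}" for t
  proof -
    have "{u \<in> C. t \<le> a u} = C" using q that by fastforce
    then show ?thesis by (simp add: level_def)
  qed
  have r: "r < card C"
  proof -
    have "q \<in> a ` C" unfolding q_def using assms(1,2) by (intro Min_in) auto
    then obtain u where "u \<in> C" "a u = q" by blast
    then have "u \<in> C" "u \<notin> {u \<in> C. Suc q \<le> a u}" by auto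
    then have "{u \<in> C. Suc q \<le> a u} \<subset> C" by blast
    then show ?thesis unfolding r_def level_def using assms(1) by (simp add: psubset_card_mono)
  qed
  have M: "(\<Sum>u\<in>C. a u) = q * card C + r"
    using sum_eq_sum_level[of C a "Suc q"] assms(1) q(2) lev by (simp add: r_def)
  have "pair_min C a = q * (card C choose 2) + (r choose 2)"
    using pair_min_eq_sum_level[of C a "Suc q"] assms(1) q(2) lev by (simp add: r_def)
  then have "2 * int (pair_min C a)
      = int q * (2 * int (card C choose 2)) + 2 * int (r choose 2)" by simp
  also have "\<dots> = fill (int (card C)) (int q * int (card C) + int r)"
    unfolding two_times_choose_2 using r by (subst fill_eq) auto
  finally show ?thesis using M by simp
qed

subsection \<open>Optimization over the class size\<close>

text \<open>Replaces the total \<open>M\<close> by its cap \<open>N\<close>. Losing one unit shrinks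
  the remainder term from \<open>d (d - 1)\<close> to \<open>(d - 1) (d - 2)\<close> with
  \<open>d = N - q s\<close>, a strict loss once \<open>d \<ge> 2\<close>. The strict form later
  forces \<open>M = N\<close> at equality.\<close>

lemma fill_bound:
  fixes w :: int
  assumes "w \<le> fill s M" "M \<le> N" "s > 0"
  shows "w \<le> q * (s * (s - 1)) + (N - q * s) * (N - q * s - 1)"
    and "M < N \<Longrightarrow> N - q * s \<ge> 2 \<Longrightarrow> w < q * (s * (s - 1)) + (N - q * s) * (N - q * s - 1)"
proof -
  have "fill s M \<le> fill s N" using assms by (intro fill_mono)
  with fill_le[OF assms(3), of N q] assms(1)
  show "w \<le> q * (s * (s - 1)) + (N - q * s) * (N - q * s - 1)" by linarith
  assume "M < N" "N - q * s \<ge> 2"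
  then have "fill s M \<le> fill s (N - 1)" using assms by (intro fill_mono) auto
  with fill_le[OF assms(3), of "N - 1" q] assms(1)
  have *: "w \<le> q * (s * (s - 1)) + (N - 1 - q * s) * (N - 1 - q * s - 1)" by linarith
  define d where "d = N - q * s"
  have "w \<le> q * (s * (s - 1)) + (d - 1) * (d - 2)"
    using * by (simp add: d_def algebra_simps)
  moreover have "(d - 1) * (d - 2) < d * (d - 1)"
    using \<open>N - q * s \<ge> 2\<close> by (simp add: d_def algebra_simps)
  ultimately show "w < q * (s * (s - 1)) + (N - q * s) * (N - q * s - 1)"
    unfolding d_def by linarith
qed

text \<open>In the four cases below, \<open>j\<close> is the distance of \<open>s\<close> from its extremal value. For large \<open>j\<close> the linear
  bound decides; for small \<open>j\<close> the bounds for \<open>q = 4\<close> and \<open>q = 3\<close> do.\<close>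

context
  fixes s M w n :: int
  assumes fill: "w \<le> fill s M" and lin: "w \<le> (s - 1) * M"
    and M: "M \<le> 2 * n - 4 * s" and s: "s > 0"
begin

lemma linear_bound: "w \<le> (s - 1) * (2 * n - 4 * s)"
  using lin M s by (intro order_trans[OF lin] mult_left_mono) auto

lemmas fill_bounds = fill_bound[OF fill M s]

text \<open>At \<open>s = k\<close> the cap is \<open>4 k\<close>, four full levels, so the linear
  bound is attained. Its peak \<open>k + 1/2\<close> does not separate \<open>s = k\<close> from
  \<open>s = k + 1\<close>; for the latter, \<open>q = 3\<close> gives a value lower by
  \<open>8 k - 56\<close>, which is positive from \<open>k = 8\<close> on.\<close>

lemma bound_mod4_0:
  fixes k :: int
  assumes k: "k \<ge> 8" "n = 4 * k"
  shows "w \<le> 4 * k^2 - 4 * k" "w = 4 * k^2 - 4 * k \<Longrightarrow> s = k \<and> M = 2 * n - 4 * s"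
proof -
  define j where "j = k - s"
  have sj: "s = k - j" by (simp add: j_def)
  have cont: "w \<le> 4 * k^2 - 4 * k - 4 * (j * (j + 1))"
    using linear_bound unfolding sj k(2) by (simp add: algebra_simps power2_eq_square)
  have q3: "w \<le> 4 * k^2 - 4 * k + 8 * (k * j) + 52 * j^2 - 4 * j"
    using fill_bounds(1)[of 3] unfolding sj k(2) by (simp add: algebra_simps power2_eq_square)
  have "w \<le> 4 * k^2 - 4 * k \<and> (w = 4 * k^2 - 4 * k \<longrightarrow> s = k \<and> M = 2 * n - 4 * s)"
  proof -
    consider "j = 0" | "j = -1" | "j \<ge> 1 \<or> j \<le> -2" by linarith
    then show ?thesis
    proof cases
      case 1
      \<comment> \<open>For \<open>q = 4\<close> the remainder would be 0, too small for the strict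
        bound; \<open>q = 3\<close> leaves remainder \<open>k\<close> and the same value.\<close>
      then have "M < 2 * n - 4 * s \<Longrightarrow> w < 4 * k^2 - 4 * k"
        using fill_bounds(2)[of 3] k unfolding sj k(2) by (simp add: algebra_simps power2_eq_square)
      then show ?thesis using cont 1 sj M by fastforce
    next
      case 2
      then show ?thesis using q3 k(1) by simp
    next
      case 3
      then have "j * (j + 1) > 0" by (auto intro: mult_pos_pos mult_neg_neg)
      then show ?thesis using cont by linarith
    qed
  qed
  then show "w \<le> 4 * k^2 - 4 * k" "w = 4 * k^2 - 4 * k \<Longrightarrow> s = k \<and> M = 2 * n - 4 * s" by auto
qed

text \<open>At \<open>s = k\<close> the cap is \<open>4 k + 2\<close>: four full levels and a
  remainder of 2. The linear bound overshoots this value by \<open>2 k - 4\<close>, so it decides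
  only beyond a distance of order \<open>sqrt k\<close>; closer in, \<open>q = 4\<close> serves
  \<open>s < k\<close> and \<open>q = 3\<close> serves \<open>s > k\<close>.\<close>

lemma bound_mod4_1:
  fixes k :: int
  assumes k: "k \<ge> 30" "n = 4 * k + 1"
  shows "w \<le> 4 * k^2 - 4 * k + 2" "w = 4 * k^2 - 4 * k + 2 \<Longrightarrow> s = k \<and> M = 2 * n - 4 * s"
proof -
  define j where "j = k - s"
  have sj: "s = k - j" by (simp add: j_def)
  have cont: "w \<le> 4 * k^2 - 4 * k + 2 * k - 2 - 4 * (j * j) - 6 * j"
    using linear_bound unfolding sj k(2) by (simp add: algebra_simps power2_eq_square)
  have q3: "w \<le> 4 * k^2 + 8 * (k * j) + 52 * (j * j) + 24 * j + 2"
    using fill_bounds(1)[of 3] unfolding sj k(2) by (simp add: algebra_simps power2_eq_square)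
  have q4: "w \<le> 4 * k^2 - 4 * k + 2 - 8 * (k * j) + 68 * (j * j) + 28 * j"
    using fill_bounds(1)[of 4] unfolding sj k(2) by (simp add: algebra_simps power2_eq_square)
  have "w \<le> 4 * k^2 - 4 * k + 2 \<and> (w = 4 * k^2 - 4 * k + 2 \<longrightarrow> s = k \<and> M = 2 * n - 4 * s)"
  proof -
    consider "j = 0" | "j \<ge> 1" | "j \<le> -1" by linarith
    then show ?thesis
    proof cases
      case 1
      then have "M < 2 * n - 4 * s \<Longrightarrow> w < 4 * k^2 - 4 * k + 2"
        using fill_bounds(2)[of 4] k unfolding sj k(2) by (simp add: algebra_simps power2_eq_square)
      then show ?thesis using q4 1 sj M by fastforce
    next
      case 2
      have "w < 4 * k^2 - 4 * k + 2"
      proof (cases "k - 2 < 2 * (j * j) + 3 * j")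
        case True then show ?thesis using cont by linarith
      next
        case False
        \<comment> \<open>What \<open>q = 4\<close> needs after division by \<open>4 j\<close>. The
          tightest case is \<open>j = 3\<close>, where \<open>58 < 2 k\<close> is exactly
          \<open>k \<ge> 30\<close>; for larger \<open>j\<close> the failed linear test makes
          \<open>k\<close> quadratic in \<open>j\<close>.\<close>
        have "17 * j + 7 < 2 * k"
        proof (cases "j \<le> 3")
          case True then show ?thesis using k by linarith
        next
          case j: False
          then have "4 * j \<le> j * j" by (intro mult_right_mono) auto
          then show ?thesis using False j by linarith
        qed
        then have "j * (17 * j + 7) < j * (2 * k)" using 2 by (intro mult_strict_left_mono) auto
        then show ?thesis using q4 by (simp add: algebra_simps)
      qed
      then show ?thesis by simp
    next
      case 3
      define i where "i = -j"
      have i: "i \<ge> 1" "j = -i" using 3 by (auto simp: i_def)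
      have "w < 4 * k^2 - 4 * k + 2"
      proof (cases "k - 2 < 2 * (i * i) - 3 * i")
        case True then show ?thesis using cont i by simp
      next
        case False
        have "13 * (i * i) - 6 * i < k * (2 * i - 1)"
        proof (cases "i \<le> 4")
          case True
          then have "i = 1 \<or> i = 2 \<or> i = 3 \<or> i = 4" using i by linarith
          then show ?thesis using k(1) by auto
        next
          case j: False
          then have ii: "5 * i \<le> i * i" by (intro mult_right_mono) auto
          then have "7 * i + 2 \<le> k" using False j by linarith
          then have "(7 * i + 2) * (2 * i - 1) \<le> k * (2 * i - 1)" using i by (intro mult_right_mono) auto
          moreover have "(7 * i + 2) * (2 * i - 1) = 14 * (i * i) - 3 * i - 2" by (simp add: algebra_simps)
          ultimately show ?thesis using i ii j by linarith
        qed
        then show ?thesis using q3 unfolding i(2) by (simp add: algebra_simps)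
      qed
      then show ?thesis by simp
    qed
  qed
  then show "w \<le> 4 * k^2 - 4 * k + 2" "w = 4 * k^2 - 4 * k + 2 \<Longrightarrow> s = k \<and> M = 2 * n - 4 * s" by auto
qed

text \<open>Two shapes reach the same value: at \<open>s = k\<close> four full levels and a
  remainder of 4, at \<open>s = k + 1\<close> three full levels and a remainder of
  \<open>k - 3\<close>.\<close>

lemma bound_mod4_2:
  fixes k :: int
  assumes k: "k \<ge> 68" "n = 4 * k + 2"
  shows "w \<le> 4 * k^2 - 4 * k + 12"
    "w = 4 * k^2 - 4 * k + 12 \<Longrightarrow> (s = k \<or> s = k + 1) \<and> M = 2 * n - 4 * s"
proof -
  define j where "j = k - s"
  have sj: "s = k - j" by (simp add: j_def)
  have cont: "w \<le> 4 * k^2 - 4 * k + 4 * k - 4 - 4 * (j * j) - 8 * j"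
    using linear_bound unfolding sj k(2) by (simp add: algebra_simps power2_eq_square)
  have q3: "w \<le> 4 * k^2 + 4 * k + 8 * (k * j) + 52 * (j * j) + 52 * j + 12"
    using fill_bounds(1)[of 3] unfolding sj k(2) by (simp add: algebra_simps power2_eq_square)
  have q4: "w \<le> 4 * k^2 - 4 * k + 12 - 8 * (k * j) + 68 * (j * j) + 60 * j"
    using fill_bounds(1)[of 4] unfolding sj k(2) by (simp add: algebra_simps power2_eq_square)
  have "w \<le> 4 * k^2 - 4 * k + 12 \<and>
      (w = 4 * k^2 - 4 * k + 12 \<longrightarrow> (s = k \<or> s = k + 1) \<and> M = 2 * n - 4 * s)"
  proof -
    consider "j = 0" | "j = -1" | "j \<ge> 1" | "j \<le> -2" by linarith
    then show ?thesis
    proof cases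
      case 1
      then have "M < 2 * n - 4 * s \<Longrightarrow> w < 4 * k^2 - 4 * k + 12"
        using fill_bounds(2)[of 4] k unfolding sj k(2) by (simp add: algebra_simps power2_eq_square)
      then show ?thesis using q4 1 sj M by fastforce
    next
      case 2
      then have "M < 2 * n - 4 * s \<Longrightarrow> w < 4 * k^2 - 4 * k + 12"
        using fill_bounds(2)[of 3] k unfolding sj k(2) by (simp add: algebra_simps power2_eq_square)
      then show ?thesis using q3 2 sj M by fastforce
    next
      case 3
      have "w < 4 * k^2 - 4 * k + 12"
      proof (cases "k < j * j + 2 * j + 4")
        case True then show ?thesis using cont by linarith
      next
        case False
        \<comment> \<open>Tightest at \<open>j = 7\<close>, where \<open>134 < 2 k\<close> is
          exactly \<open>k \<ge> 68\<close>.\<close>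
        have "17 * j + 15 < 2 * k"
        proof (cases "j \<le> 7")
          case True then show ?thesis using k by linarith
        next
          case j: False
          then have "8 * j \<le> j * j" by (intro mult_right_mono) auto
          then show ?thesis using False j by linarith
        qed
        then have "j * (17 * j + 15) < j * (2 * k)" using 3 by (intro mult_strict_left_mono) auto
        then show ?thesis using q4 by (simp add: algebra_simps)
      qed
      then show ?thesis by simp
    next
      case 4
      define i where "i = -j"
      have i: "i \<ge> 2" "j = -i" using 4 by (auto simp: i_def)
      have "w < 4 * k^2 - 4 * k + 12"
      proof (cases "k < i * i - 2 * i + 4")
        case True then show ?thesis using cont i by simp
      next
        case False
        \<comment> \<open>The bound for \<open>q = 3\<close> differs from the target by a multiple
          of \<open>i - 1\<close>, which vanishes at the second optimum \<open>i = 1\<close> and is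
          divided out here.\<close>
        have "13 * i < 2 * k"
        proof (cases "i \<le> 10")
          case True then show ?thesis using k by linarith
        next
          case j: False
          then have "11 * i \<le> i * i" by (intro mult_right_mono) auto
          then show ?thesis using False j by linarith
        qed
        then have "(i - 1) * (13 * i) < (i - 1) * (2 * k)" using i by (intro mult_strict_left_mono) auto
        then show ?thesis using q3 unfolding i(2) by (simp add: algebra_simps)
      qed
      then show ?thesis by simp
    qed
  qed
  then show "w \<le> 4 * k^2 - 4 * k + 12"
    "w = 4 * k^2 - 4 * k + 12 \<Longrightarrow> (s = k \<or> s = k + 1) \<and> M = 2 * n - 4 * s" by auto
qed

text \<open>Recentred at \<open>K = k + 1\<close>, the optimal size: there the cap is
  \<open>4 K - 2\<close>, that is, three full levels and a remainder of
  \<open>K - 2\<close>.\<close>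

lemma bound_mod4_3:
  fixes k :: int
  assumes k: "k \<ge> 30" "n = 4 * k + 3"
  shows "w \<le> 4 * k^2 + 2" "w = 4 * k^2 + 2 \<Longrightarrow> s = k + 1 \<and> M = 2 * n - 4 * s"
proof -
  define K j where "K = k + 1" and "j = K - s"
  have sj: "s = K - j" and kK: "k = K - 1" by (simp_all add: j_def K_def)
  have nK: "n = 4 * K - 1" and K: "K \<ge> 31" using k kK by auto
  have B: "4 * k^2 + 2 = 4 * K^2 - 8 * K + 6" unfolding kK by (simp add: algebra_simps power2_eq_square)
  have cont: "w \<le> 4 * K^2 - 6 * K + 2 - 4 * (j * j) - 2 * j"
    using linear_bound unfolding sj nK by (simp add: algebra_simps power2_eq_square)
  have q3: "w \<le> 4 * K^2 - 8 * K + 6 + 8 * (K * j) + 52 * (j * j) - 32 * j"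
    using fill_bounds(1)[of 3] unfolding sj nK by (simp add: algebra_simps power2_eq_square)
  have q4: "w \<le> 4 * K^2 - 4 * K + 6 - 8 * (K * j) + 68 * (j * j) - 36 * j"
    using fill_bounds(1)[of 4] unfolding sj nK by (simp add: algebra_simps power2_eq_square)
  have "w \<le> 4 * K^2 - 8 * K + 6 \<and> (w = 4 * K^2 - 8 * K + 6 \<longrightarrow> s = K \<and> M = 2 * n - 4 * s)"
  proof -
    consider "j = 0" | "j \<ge> 1" | "j \<le> -1" by linarith
    then show ?thesis
    proof cases
      case 1
      then have "M < 2 * n - 4 * s \<Longrightarrow> w < 4 * K^2 - 8 * K + 6"
        using fill_bounds(2)[of 3] K unfolding sj nK by (simp add: algebra_simps power2_eq_square)
      then show ?thesis using q3 1 sj M by fastforce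
    next
      case 2
      have "w < 4 * K^2 - 8 * K + 6"
      proof (cases "K - 2 < 2 * (j * j) + j")
        case True then show ?thesis using cont by linarith
      next
        case False
        have "17 * (j * j) - 9 * j < K * (2 * j - 1)"
        proof (cases "j \<le> 3")
          case True
          then have "j = 1 \<or> j = 2 \<or> j = 3" using 2 by linarith
          then show ?thesis using K by auto
        next
          case j: False
          then have jj: "4 * j \<le> j * j" by (intro mult_right_mono) auto
          then have "9 * j + 2 \<le> K" using False j by linarith
          then have "(9 * j + 2) * (2 * j - 1) \<le> K * (2 * j - 1)" using 2 by (intro mult_right_mono) auto
          moreover have "(9 * j + 2) * (2 * j - 1) = 18 * (j * j) - 5 * j - 2" by (simp add: algebra_simps)
          ultimately show ?thesis using j jj by linarith
        qed
        then show ?thesis using q4 by (simp add: algebra_simps)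
      qed
      then show ?thesis by simp
    next
      case 3
      define i where "i = -j"
      have i: "i \<ge> 1" "j = -i" using 3 by (auto simp: i_def)
      have "w < 4 * K^2 - 8 * K + 6"
      proof (cases "K - 2 < 2 * (i * i) - i")
        case True then show ?thesis using cont i by simp
      next
        case False
        \<comment> \<open>Tightest at \<open>i = 4\<close>, where \<open>60 < 2 K\<close> is exactly
          \<open>k \<ge> 30\<close>.\<close>
        have "13 * i + 8 < 2 * K"
        proof (cases "i \<le> 4")
          case True then show ?thesis using K i by (cases "i = 4") auto
        next
          case j: False
          then have "5 * i \<le> i * i" by (intro mult_right_mono) auto
          then show ?thesis using False j by linarith
        qed
        then have "i * (13 * i + 8) < i * (2 * K)" using i by (intro mult_strict_left_mono) auto
        then show ?thesis using q3 unfolding i(2) by (simp add: algebra_simps)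
      qed
      then show ?thesis by simp
    qed
  qed
  then show "w \<le> 4 * k^2 + 2" "w = 4 * k^2 + 2 \<Longrightarrow> s = k + 1 \<and> M = 2 * n - 4 * s"
    unfolding B using kK by auto
qed

end

subsection \<open>Cuts with two edges\<close>

text \<open>A walk from \<open>u\<close> only uses edges whose ends it reaches. After the trimming,
  any vertex touched by a kept edge can be reached from \<open>u\<close>.\<close>

lemma joined_trim:
  assumes "joined G A u w"
  shows "joined G {f \<in> A. \<forall>x\<in>ends G f. joined G A u x} u w"
  using assms
proof (induction rule: joined_induct)
  case (step a b e)
  have "joined G A u b" using step joined_edge joined_trans by metis
  then have "joined G {f \<in> A. \<forall>x\<in>ends G f. joined G A u x} a b"
    using step by (intro joined_edge[of e]) auto
  with step.IH show ?case by (rule joined_trans)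
qed simp

text \<open>A walk that uses \<open>e\<close> is stopped just before its first use, at one of the
  ends of \<open>e\<close>.\<close>

lemma joined_remove_edge:
  assumes "joined G A u x" "ends G e = {w, v}"
  shows "joined G (A - {e}) u x \<or> joined G (A - {e}) u w \<or> joined G (A - {e}) u v"
  using assms(1)
proof (induction rule: joined_induct)
  case (step a b f)
  show ?case
  proof (cases "joined G (A - {e}) u a \<and> f \<noteq> e")
    case True
    then have "joined G (A - {e}) a b" using step by (intro joined_edge[of f]) auto
    then show ?thesis using True joined_trans by metis
  next
    case False
    then show ?thesis using step assms(2) by (auto simp: doubleton_eq_iff)
  qed
qed simp

text \<open>The case of two paths in Menger's theorem, by Whitney's argument: a detour around the last
  edge of a path is attached to one of two edge-disjoint paths that reach the other end of that
  edge.\<close>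

lemma two_disjoint_joined_step:
  assumes mg: "multigraph G"
    and cuts: "\<And>X. X \<subset> verts G \<Longrightarrow> X \<noteq> {} \<Longrightarrow> 2 \<le> card (cut_edges G X)"
    and u: "u \<in> verts G" and e: "e \<in> edges G" "ends G e = {w, v}"
    and AB: "A \<subseteq> edges G" "B \<subseteq> edges G" "A \<inter> B = {}" "joined G A u w" "joined G B u w"
  shows "\<exists>A B. A \<subseteq> edges G \<and> B \<subseteq> edges G \<and> A \<inter> B = {} \<and> joined G A u v \<and> joined G B u v"
proof -
  have wv: "joined G {e} w v" using e by (intro joined_edge) auto
  \<comment> \<open>It suffices that one set reaches \<open>v\<close> without \<open>e\<close> while
    the other reaches \<open>w\<close>: the latter is extended by \<open>e\<close>.\<close>
  have step: ?thesis if "A' \<subseteq> edges G" "B' \<subseteq> edges G" "A' \<inter> B' = {}" "e \<notin> A'"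
    "joined G A' u v" "joined G B' u w" for A' B'
  proof (intro exI conjI)
    show "joined G (B' \<union> {e}) u v"
      using that(6) wv joined_mono joined_trans by (metis Un_upper1 Un_upper2)
  qed (use that e in auto)
  show ?thesis
  proof (cases "joined G (A - {e}) u v \<or> joined G (B - {e}) u v")
    case True
    then show ?thesis using step[of "A - {e}" B] step[of "B - {e}" A] AB by blast
  next
    case False
    then have A1: "joined G (A - {e}) u w" and B1: "joined G (B - {e}) u w"
      using joined_remove_edge[OF AB(4) e(2)] joined_remove_edge[OF AB(5) e(2)] by auto
    \<comment> \<open>Trimming makes every edge of \<open>A'\<close> or \<open>B'\<close> an access
      point: a detour that touches it has met a vertex which that set reaches from
      \<open>u\<close>.\<close>
    define A' where "A' = {f \<in> A - {e}. \<forall>x\<in>ends G f. joined G (A - {e}) u x}"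
    define B' where "B' = {f \<in> B - {e}. \<forall>x\<in>ends G f. joined G (B - {e}) u x}"
    have tA: "joined G A' u x" if "joined G (A - {e}) u x" for x
      unfolding A'_def using that by (rule joined_trim)
    have tB: "joined G B' u x" if "joined G (B - {e}) u x" for x
      unfolding B'_def using that by (rule joined_trim)
    have sub: "A' \<subseteq> edges G" "B' \<subseteq> edges G" "A' \<inter> B' = {}" "e \<notin> A'" "e \<notin> B'"
      using AB by (auto simp: A'_def B'_def)
    define F where "F = edges G - {e} - A' - B'"
    define X where "X = {x \<in> verts G. joined G F v x}"
    have v: "v \<in> verts G" using e mg by (auto simp: multigraph_def)
    have "\<exists>x. joined G F v x \<and> (joined G A' u x \<or> joined G B' u x)"
    proof (rule ccontr)
      assume no: "\<not> ?thesis"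
      have "u \<notin> X" using no by (auto simp: X_def)
      then have "X \<subset> verts G" using u by (auto simp: X_def)
      moreover have "v \<in> X" using v by (simp add: X_def)
      ultimately have "2 \<le> card (cut_edges G X)" using cuts[of X] by blast
      then have "\<not> cut_edges G X \<subseteq> {e}" using card_mono[of "{e}" "cut_edges G X"] by auto
      then obtain f where f: "f \<in> cut_edges G X" "f \<noteq> e" by blast
      have "F \<inter> cut_edges G X = {}"
        unfolding X_def using mg by (rule cut_edges_joined_set) (auto simp: F_def)
      then have "f \<in> A' \<or> f \<in> B'" using f by (auto simp: F_def cut_edges_def)
      moreover obtain x where "x \<in> ends G f" "x \<in> X" using f by (auto simp: cut_edges_def)
      ultimately show False using no tA tB by (auto simp: A'_def B'_def X_def)
    qed
    then obtain x where x: "joined G F v x" "joined G A' u x \<or> joined G B' u x" by blast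
    have xv: "joined G F x v" using x(1) by (rule joined_sym)
    from x(2) show ?thesis
    proof
      assume "joined G A' u x"
      then have "joined G (A' \<union> F) u v"
        using xv joined_mono joined_trans by (metis Un_upper1 Un_upper2)
      moreover have "A' \<union> F \<subseteq> edges G" "(A' \<union> F) \<inter> B' = {}" "e \<notin> A' \<union> F"
        using sub by (auto simp: F_def)
      ultimately show ?thesis using step[of "A' \<union> F" B'] sub(2) tB[OF B1] by blast
    next
      assume "joined G B' u x"
      then have "joined G (B' \<union> F) u v"
        using xv joined_mono joined_trans by (metis Un_upper1 Un_upper2)
      moreover have "B' \<union> F \<subseteq> edges G" "(B' \<union> F) \<inter> A' = {}" "e \<notin> B' \<union> F"
        using sub by (auto simp: F_def)
      ultimately show ?thesis using step[of "B' \<union> F" A'] sub(1) tA[OF A1] by blast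
    qed
  qed
qed

text \<open>Makes the connectivity of a pair with a vertex of degree 2 exactly 2, as the sufficiency
  of the extremal structure requires. Two disjoint sets are carried edge by edge along any walk from
  \<open>u\<close> to \<open>v\<close>.\<close>

lemma two_le_local_edge_connectivity:
  assumes mg: "multigraph G"
    and cuts: "\<And>X. X \<subset> verts G \<Longrightarrow> X \<noteq> {} \<Longrightarrow> 2 \<le> card (cut_edges G X)"
    and uv: "u \<in> verts G" "v \<in> verts G" "u \<noteq> v"
  shows "2 \<le> local_edge_connectivity G u v"
proof -
  have "joined G (edges G) u v"
  proof (rule ccontr)
    assume nj: "\<not> joined G (edges G) u v"
    let ?X = "{x \<in> verts G. joined G (edges G) u x}"
    have "edges G \<inter> cut_edges G ?X = {}" using mg by (rule cut_edges_joined_set) simp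
    then have "cut_edges G ?X = {}" by (auto simp: cut_edges_def)
    moreover have "?X \<subset> verts G" "?X \<noteq> {}" using uv nj by auto
    ultimately show False using cuts[of ?X] by simp
  qed
  then have "\<exists>A B. A \<subseteq> edges G \<and> B \<subseteq> edges G \<and> A \<inter> B = {} \<and> joined G A u v \<and> joined G B u v"
  proof (induction rule: joined_induct)
    case refl
    show ?case by (intro exI[of _ "{}"]) auto
  next
    case (step a b e)
    from step.IH obtain A B
      where AB: "A \<subseteq> edges G" "B \<subseteq> edges G" "A \<inter> B = {}" "joined G A u a" "joined G B u a"
      by auto
    show ?case
      by (rule two_disjoint_joined_step[OF mg _ uv(1) step.hyps(2,3) AB]) (rule cuts)
  qed
  then obtain A B where AB: "A \<subseteq> edges G" "B \<subseteq> edges G" "A \<inter> B = {}" "joined G A u v" "joined G B u v"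
    by auto
  have "packing G u v 2"
    unfolding packing_def
  proof (intro exI[of _ "\<lambda>i::nat. if i = 0 then A else B"] conjI)
    show "disjoint_family_on (\<lambda>i::nat. if i = 0 then A else B) {..<2}"
      using AB(3) by (auto simp: disjoint_family_on_def)
  qed (use AB in auto)
  then show ?thesis using le_local_edge_connectivity_iff[OF mg uv(1,3)] by simp
qed

section \<open>Tied vertices and the number of edges\<close>

text \<open>By Menger's theorem, for distinct vertices this is local edge-connectivity at least 3.
  In the cut form transitivity is immediate: a set separating \<open>u\<close> from \<open>w\<close>
  separates \<open>v\<close> from one of them.\<close>

definition tied :: "('v, 'e) mgraph \<Rightarrow> 'v \<Rightarrow> 'v \<Rightarrow> bool" where
  "tied G u v \<longleftrightarrow> (\<forall>X. (u \<in> X) \<noteq> (v \<in> X) \<longrightarrow> 3 \<le> card (cut_edges G X))"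

definition tie_class :: "('v, 'e) mgraph \<Rightarrow> 'v \<Rightarrow> 'v set" where
  "tie_class G u = {v \<in> verts G. tied G u v}"

lemma tied_refl [simp]: "tied G u u" by (simp add: tied_def)

lemma tied_sym: "tied G u v \<Longrightarrow> tied G v u" by (auto simp: tied_def)

lemma tied_trans: "tied G u v \<Longrightarrow> tied G v w \<Longrightarrow> tied G u w" by (auto simp: tied_def)

lemma tie_class_eq_iff: "v \<in> verts G \<Longrightarrow> tie_class G u = tie_class G v \<longleftrightarrow> tied G u v"
  unfolding tie_class_def using tied_refl tied_sym tied_trans by fast

lemma sum_degree:
  assumes "multigraph G"
  shows "(\<Sum>v\<in>verts G. degree G v) = 2 * card (edges G)"
proof -
  have fin: "finite (verts G)" "finite (edges G)" using assms by (auto simp: multigraph_def)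
  have "(\<Sum>v\<in>verts G. degree G v) = (\<Sum>v\<in>verts G. \<Sum>e\<in>edges G. if v \<in> ends G e then 1 else 0)"
    using fin by (simp add: degree_def sum.If_cases Int_def)
  also have "\<dots> = (\<Sum>e\<in>edges G. \<Sum>v\<in>verts G. if v \<in> ends G e then 1 else 0)" by (rule sum.swap)
  also have "\<dots> = (\<Sum>e\<in>edges G. 2)"
  proof (rule sum.cong)
    fix e assume "e \<in> edges G"
    then have "ends G e \<subseteq> verts G" "card (ends G e) = 2" using assms by (auto simp: multigraph_def)
    then show "(\<Sum>v\<in>verts G. if v \<in> ends G e then 1 else 0) = (2::nat)"
      using fin by (simp add: sum.If_cases Int_absorb1)
  qed simp
  finally show ?thesis by simp
qed

text \<open>A cut with at most two edges splits \<open>X\<close> without splitting a class.\<close>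

lemma card_image_tie_class_ge:
  assumes mg: "multigraph G" and "X \<subseteq> verts G" "X \<noteq> {}"
    and untied: "\<And>e u v. e \<in> edges G \<Longrightarrow> ends G e = {u, v} \<Longrightarrow> \<not> tied G u v"
  shows "card {e \<in> edges G. ends G e \<subseteq> X} + 2 \<le> 2 * card (tie_class G ` X)"
proof -
  have fin: "finite (edges G)" using mg by (auto simp: multigraph_def)
  have "finite X" using assms(1,2) finite_subset by (auto simp: multigraph_def)
  then show ?thesis using assms(2,3)
  proof (induction X rule: finite_psubset_induct)
    case (psubset X)
    let ?E = "\<lambda>X. {e \<in> edges G. ends G e \<subseteq> X}"
    show ?case
    proof (cases "\<forall>u\<in>X. \<forall>v\<in>X. tied G u v")
      case True
      \<comment> \<open>All of \<open>X\<close> is tied while edges join untied vertices; the claim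
        becomes \<open>0 + 2 \<le> 2 * card (tie_class G\<close> followed by the image of
        \<open>X\<close>), true since \<open>X\<close> is nonempty.\<close>
      have "?E X = {}"
      proof (rule ccontr)
        assume "?E X \<noteq> {}"
        then obtain e where e: "e \<in> edges G" "ends G e \<subseteq> X" by blast
        then obtain u v where "ends G e = {u, v}" using mg by (auto simp: multigraph_def card_2_iff)
        then show False using e True untied[of e u v] by auto
      qed
      moreover have "card (tie_class G ` X) > 0" using psubset by (auto simp: card_gt_0_iff)
      ultimately show ?thesis by (simp only: card.empty)
    next
      case False
      then obtain u v where uv: "u \<in> X" "v \<in> X" "\<not> tied G u v" by blast
      from uv(3) obtain Y where Y: "(u \<in> Y) \<noteq> (v \<in> Y)" "\<not> 3 \<le> card (cut_edges G Y)"
        unfolding tied_def by blast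
      have A: "X \<inter> Y \<subset> X" "X \<inter> Y \<noteq> {}" and B: "X - Y \<subset> X" "X - Y \<noteq> {}"
        using uv Y by auto
      have ih: "card (?E (X \<inter> Y)) + 2 \<le> 2 * card (tie_class G ` (X \<inter> Y))"
        "card (?E (X - Y)) + 2 \<le> 2 * card (tie_class G ` (X - Y))"
        using psubset.IH[OF A(1)] psubset.IH[OF B(1)] A B psubset.prems by auto
      \<comment> \<open>Edges inside \<open>X\<close> lie in one of the two parts or cross
        \<open>Y\<close>. Of the two summands 2 in the induction hypotheses, one pays for the cut
        and the other remains.\<close>
      have "?E X \<subseteq> ?E (X \<inter> Y) \<union> ?E (X - Y) \<union> cut_edges G Y"
        by (auto simp: cut_edges_def)
      then have "card (?E X) \<le> card (?E (X \<inter> Y) \<union> ?E (X - Y) \<union> cut_edges G Y)"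
        using fin by (intro card_mono) (auto simp: cut_edges_def)
      also have "\<dots> \<le> card (?E (X \<inter> Y)) + card (?E (X - Y)) + card (cut_edges G Y)"
        using card_Un_le[of "?E (X \<inter> Y) \<union> ?E (X - Y)" "cut_edges G Y"]
          card_Un_le[of "?E (X \<inter> Y)" "?E (X - Y)"] by linarith
      finally have le: "card (?E X) \<le> card (?E (X \<inter> Y)) + card (?E (X - Y)) + 2" using Y(2) by linarith
      \<comment> \<open>The small cut of \<open>Y\<close> unties any two vertices that it separates,
        so no class is counted in both parts.\<close>
      have "tie_class G ` (X \<inter> Y) \<inter> tie_class G ` (X - Y) = {}"
      proof (rule ccontr)
        assume "\<not> ?thesis"
        then obtain a b where ab: "a \<in> X \<inter> Y" "b \<in> X - Y" "tie_class G a = tie_class G b" by blast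
        moreover have "b \<in> verts G" using ab(2) psubset.prems(1) by blast
        ultimately have "tied G a b" using tie_class_eq_iff[of b G a] by simp
        moreover have "(a \<in> Y) \<noteq> (b \<in> Y)" using ab by blast
        ultimately show False using Y(2) unfolding tied_def by blast
      qed
      moreover have "tie_class G ` X = tie_class G ` (X \<inter> Y) \<union> tie_class G ` (X - Y)" by blast
      ultimately have "card (tie_class G ` X) = card (tie_class G ` (X \<inter> Y)) + card (tie_class G ` (X - Y))"
        using psubset.hyps by (simp add: card_Un_disjoint)
      then show ?thesis using ih le by linarith
    qed
  qed
qed

subsection \<open>Minimally 2-edge-connected graphs\<close>

definition tie_classes :: "('v, 'e) mgraph \<Rightarrow> 'v set set" where
  "tie_classes G = tie_class G ` verts G"

text \<open>The truncated subtraction is exact on the vertices of a minimally 2-edge-connected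
  graph, see \<open>degree_eq\<close>.\<close>

definition excess :: "('v, 'e) mgraph \<Rightarrow> 'v \<Rightarrow> nat" where
  "excess G v = degree G v - 2"

definition tie_weight :: "('v, 'e) mgraph \<Rightarrow> 'v set \<Rightarrow> nat" where
  "tie_weight G p = (if \<exists>C\<in>tie_classes G. p \<subseteq> C then Min (excess G ` p) else 0)"

lemma pair_min_trivial:
  assumes "finite C" "card C \<le> 1"
  shows "pair_min C a = 0"
proof -
  have "\<not> (p \<subseteq> C \<and> card p = 2)" for p using card_mono[OF assms(1), of p] assms(2) by auto
  then have "pairs C = {}" by blast
  then show ?thesis by (simp only: pair_min_def sum.empty)
qed

lemma card_pairs: "finite C \<Longrightarrow> card (pairs C) = card C choose 2"
  by (rule n_subsets)

locale min_2_edge_connected =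
  fixes G :: "('v, 'e) mgraph"
  assumes mg: "multigraph G" and min2: "minimally_2_edge_connected G"
begin

abbreviation "V \<equiv> verts G"
abbreviation "E \<equiv> edges G"
abbreviation "n \<equiv> card V"

lemma finite_V [simp]: "finite V" and finite_E [simp]: "finite E"
  using mg by (auto simp: multigraph_def)

lemma order_ge_2: "n \<ge> 2"
  using min2 by (simp add: minimally_2_edge_connected_def graph_order_def)

lemmas cut_ge_2 = minimally_2_edge_connected_cuts(1)[OF mg min2]

lemma edge_untied:
  assumes "e \<in> E" "ends G e = {u, v}"
  shows "\<not> tied G u v"
proof -
  obtain X where X: "e \<in> cut_edges G X" "card (cut_edges G X) \<le> 2"
    using minimally_2_edge_connected_cuts(2)[OF mg min2 assms(1)] by blast
  then have "(u \<in> X) \<noteq> (v \<in> X)" using assms by (auto simp: cut_edges_def)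
  then show ?thesis using X(2) by (fastforce simp: tied_def)
qed

lemma degree_ge_2:
  assumes "v \<in> V"
  shows "2 \<le> degree G v"
proof -
  have "{v} \<noteq> V"
  proof
    assume "{v} = V"
    then have "n = card {v}" by simp
    then show False using order_ge_2 by simp
  qed
  then have "{v} \<subset> V" using assms by blast
  from cut_ge_2[OF this] show ?thesis by (simp add: cut_edges_singleton[OF mg] degree_def)
qed

lemma degree_eq: "v \<in> V \<Longrightarrow> degree G v = 2 + excess G v"
  using degree_ge_2[of v] by (simp add: excess_def)

lemma finite_tie_classes [simp]: "finite (tie_classes G)"
  by (simp add: tie_classes_def)

lemma tie_classD:
  assumes "C \<in> tie_classes G"
  shows "C \<subseteq> V" "C \<noteq> {}" "finite C" "\<And>u v. u \<in> C \<Longrightarrow> v \<in> C \<Longrightarrow> tied G u v"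
    "\<And>u v. u \<in> C \<Longrightarrow> v \<in> V \<Longrightarrow> tied G u v \<Longrightarrow> v \<in> C"
proof -
  obtain w where w: "w \<in> V" "C = tie_class G w" using assms by (auto simp: tie_classes_def)
  show "C \<subseteq> V" using w by (auto simp: tie_class_def)
  then show "finite C" using finite_V finite_subset by blast
  have "w \<in> C" using w by (simp add: tie_class_def)
  then show "C \<noteq> {}" by blast
  show "tied G u v" if "u \<in> C" "v \<in> C" for u v
  proof -
    have "tied G w u" "tied G w v" using that w by (auto simp: tie_class_def)
    then show ?thesis using tied_sym tied_trans by metis
  qed
  show "v \<in> C" if "u \<in> C" "v \<in> V" "tied G u v" for u v
  proof -
    have "tied G w u" using that w by (auto simp: tie_class_def)
    then have "tied G w v" using that(3) by (rule tied_trans)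
    then show ?thesis using that w by (simp add: tie_class_def)
  qed
qed

lemma tie_classes_disjoint:
  assumes "C \<in> tie_classes G" "D \<in> tie_classes G" "x \<in> C" "x \<in> D"
  shows "C = D"
  using assms tie_classD by (metis subsetD subset_antisym subsetI)

lemma Union_tie_classes: "\<Union>(tie_classes G) = V"
proof -
  have "v \<in> tie_class G v" if "v \<in> V" for v using that by (simp add: tie_class_def)
  then show ?thesis using tie_classD(1) by (auto simp: tie_classes_def)
qed

lemma sum_tie_classes: "(\<Sum>C\<in>tie_classes G. \<Sum>u\<in>C. f u) = (\<Sum>u\<in>V. f u)" for f :: "'v \<Rightarrow> nat"
  unfolding Union_tie_classes[symmetric]
  using tie_classD(3) tie_classes_disjoint by (subst sum.Union_disjoint) auto

lemma card_edges_le: "card E + 2 \<le> 2 * card (tie_classes G)"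
proof -
  have "{e \<in> E. ends G e \<subseteq> V} = E" using mg by (auto simp: multigraph_def)
  moreover have "V \<noteq> {}" using order_ge_2 by auto
  ultimately show ?thesis
    using card_image_tie_class_ge[OF mg, of V] edge_untied by (simp add: tie_classes_def)
qed

lemma sum_excess: "(\<Sum>v\<in>V. excess G v) + 2 * n = 2 * card E"
proof -
  have "(\<Sum>v\<in>V. degree G v) = (\<Sum>v\<in>V. 2 + excess G v)"
    by (intro sum.cong refl degree_eq)
  also have "\<dots> = 2 * n + (\<Sum>v\<in>V. excess G v)" by (simp only: sum.distrib sum_constant mult.commute of_nat_id)
  finally show ?thesis using sum_degree[OF mg] by simp
qed

text \<open>The other classes are nonempty and partition the remaining vertices; if there are as
  many of them as such vertices, they are singletons.\<close>

lemma card_tie_classes_le: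
  assumes "C \<in> tie_classes G"
  shows "card (tie_classes G) + card C \<le> n + 1"
    and "card (tie_classes G) + card C = n + 1 \<Longrightarrow> D \<in> tie_classes G \<Longrightarrow> D \<noteq> C \<Longrightarrow> card D = 1"
proof -
  have "n = (\<Sum>D\<in>tie_classes G. card D)" using sum_tie_classes[of "\<lambda>_. 1"] by simp
  also have "\<dots> = card C + (\<Sum>D\<in>tie_classes G - {C}. card D)"
    using assms by (intro sum.remove) auto
  finally have n: "n = card C + (\<Sum>D\<in>tie_classes G - {C}. card D)" .
  have ge: "1 \<le> card D" if "D \<in> tie_classes G - {C}" for D
    using that tie_classD(2,3) by (simp add: Suc_leI card_gt_0_iff)
  then have le: "(\<Sum>D\<in>tie_classes G - {C}. 1) \<le> (\<Sum>D\<in>tie_classes G - {C}. card D)"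
    by (rule sum_mono)
  have card: "card (tie_classes G - {C}) + 1 = card (tie_classes G)"
    using assms by (metis Suc_eq_plus1 card_Suc_Diff1 finite_tie_classes)
  show "card (tie_classes G) + card C \<le> n + 1" using n le card by simp
  assume eq: "card (tie_classes G) + card C = n + 1" and D: "D \<in> tie_classes G" "D \<noteq> C"
  have "(\<Sum>D\<in>tie_classes G - {C}. 1) = (\<Sum>D\<in>tie_classes G - {C}. card D)"
    using eq n card by simp
  from sum_mono_inv[OF this ge, of D] D show "card D = 1" by simp
qed

lemma pairE:
  assumes "p \<in> pairs V"
  obtains u v where "p = {u, v}" "u \<noteq> v" "u \<in> V" "v \<in> V"
  using assms by (auto simp: card_2_iff)

lemma pair_edge_connectivity_le:
  assumes "p \<in> pairs V"
  shows "pair_edge_connectivity G p \<le> 2 + tie_weight G p"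
proof -
  obtain u v where uv: "p = {u, v}" "u \<noteq> v" "u \<in> V" "v \<in> V" using assms by (rule pairE)
  show ?thesis
  proof (cases "\<exists>C\<in>tie_classes G. p \<subseteq> C")
    case True
    then have "tie_weight G p = min (excess G u) (excess G v)"
      using uv by (simp add: tie_weight_def)
    then show ?thesis
      using local_edge_connectivity_le_degree[OF mg uv(3,4,2)] degree_eq[OF uv(3)] degree_eq[OF uv(4)] uv(1)
      by simp
  next
    case False
    have "\<not> tied G u v"
    proof
      assume "tied G u v"
      then have "p \<subseteq> tie_class G u" using uv by (simp add: tie_class_def)
      then show False using False uv by (auto simp: tie_classes_def)
    qed
    then obtain X where "(u \<in> X) \<noteq> (v \<in> X)" "\<not> 3 \<le> card (cut_edges G X)"
      unfolding tied_def by blast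
    then show ?thesis using local_edge_connectivity_le_card_cut_edges[OF mg uv(3), of X v] uv by simp
  qed
qed

lemma local_edge_connectivity_ge_2:
  assumes "u \<in> V" "v \<in> V" "u \<noteq> v"
  shows "2 \<le> local_edge_connectivity G u v"
  using two_le_local_edge_connectivity[OF mg _ assms] cut_ge_2 by blast

lemma sum_tie_weight: "(\<Sum>p\<in>pairs V. tie_weight G p) = (\<Sum>C\<in>tie_classes G. pair_min C (excess G))"
proof -
  let ?T = "\<Union>C\<in>tie_classes G. pairs C"
  have T: "?T \<subseteq> pairs V" using tie_classD(1) by blast
  have "(\<Sum>p\<in>pairs V. tie_weight G p) = (\<Sum>p\<in>?T. tie_weight G p)"
    using T by (intro sum.mono_neutral_right) (auto simp: tie_weight_def)
  also have "\<dots> = (\<Sum>C\<in>tie_classes G. \<Sum>p\<in>pairs C. tie_weight G p)"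
  proof (rule sum.UNION_disjoint)
    show "\<forall>C\<in>tie_classes G. finite (pairs C)" using tie_classD(3) by simp
    show "\<forall>C\<in>tie_classes G. \<forall>D\<in>tie_classes G. C \<noteq> D \<longrightarrow> pairs C \<inter> pairs D = {}"
    proof (intro ballI impI, rule ccontr)
      fix C D assume CD: "C \<in> tie_classes G" "D \<in> tie_classes G" "C \<noteq> D" "pairs C \<inter> pairs D \<noteq> {}"
      then obtain p where p: "p \<subseteq> C" "p \<subseteq> D" "card p = 2" by blast
      then obtain x where "x \<in> p" by fastforce
      then show False using p CD tie_classes_disjoint by blast
    qed
  qed simp
  also have "\<dots> = (\<Sum>C\<in>tie_classes G. pair_min C (excess G))"
    unfolding pair_min_def by (intro sum.cong refl) (auto simp: tie_weight_def)
  finally show ?thesis .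
qed

section \<open>Nontrivial classes and the largest class\<close>

definition big_classes :: "'v set set" where
  "big_classes = {C \<in> tie_classes G. 2 \<le> card C}"

text \<open>Singletons contain no pairs, so their excess is left out. If this sum still reaches its
  cap, nothing remains for them and their vertices have degree 2.\<close>

definition big_excess :: nat where
  "big_excess = (\<Sum>C\<in>big_classes. \<Sum>u\<in>C. excess G u)"

definition class_size :: nat where
  "class_size = Max (card ` tie_classes G)"

lemma big_classes_subset: "big_classes \<subseteq> tie_classes G"
  by (auto simp: big_classes_def)

lemma class_size_attained: obtains C where "C \<in> tie_classes G" "card C = class_size"
proof -
  have "tie_classes G \<noteq> {}" using order_ge_2 by (auto simp: tie_classes_def)
  then have "class_size \<in> card ` tie_classes G" unfolding class_size_def by (intro Max_in) auto
  then show ?thesis using that by auto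
qed

lemma card_le_class_size: "C \<in> tie_classes G \<Longrightarrow> card C \<le> class_size"
  by (simp add: class_size_def)

lemma class_size_pos: "class_size > 0"
proof -
  obtain C where "C \<in> tie_classes G" "card C = class_size" by (rule class_size_attained)
  then show ?thesis using tie_classD(2,3) by (metis card_gt_0_iff)
qed

lemma sum_tie_weight_big: "(\<Sum>p\<in>pairs V. tie_weight G p) = (\<Sum>C\<in>big_classes. pair_min C (excess G))"
  unfolding sum_tie_weight
proof (rule sum.mono_neutral_right)
  show "\<forall>C\<in>tie_classes G - big_classes. pair_min C (excess G) = 0"
  proof
    fix C assume "C \<in> tie_classes G - big_classes"
    then have "finite C" "card C \<le> 1" using tie_classD(3) by (auto simp: big_classes_def)
    then show "pair_min C (excess G) = 0" by (rule pair_min_trivial)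
  qed
qed (auto simp: big_classes_def)

lemma big_excess_le: "big_excess \<le> (\<Sum>v\<in>V. excess G v)"
  unfolding big_excess_def sum_tie_classes[symmetric]
  by (rule sum_mono2) (auto simp: big_classes_def)

text \<open>Supplies the hypotheses of the optimization over \<open>s\<close>. With \<open>N\<close>
  classes, the cap comes from \<open>2 |E| - 2 n \<le> 4 (N - 1) - 2 n\<close> and
  \<open>N \<le> n - s + 1\<close>.\<close>

lemma weight_bounds:
  defines "w \<equiv> 2 * int (\<Sum>p\<in>pairs V. tie_weight G p)"
  shows "w \<le> fill (int class_size) (int big_excess)"
    and "w \<le> (int class_size - 1) * int big_excess"
    and "int big_excess \<le> 2 * int n - 4 * int class_size"
proof -
  have fin: "finite big_classes" using finite_subset[OF big_classes_subset] by simp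
  have C: "finite C \<and> card C \<le> class_size" if "C \<in> big_classes" for C
    using that tie_classD(3) card_le_class_size by (auto simp: big_classes_def)
  note b = sum_pair_min_bounds[OF fin C class_size_pos, of "excess G"]
  show "w \<le> fill (int class_size) (int big_excess)"
    and "w \<le> (int class_size - 1) * int big_excess"
    using b unfolding w_def sum_tie_weight_big big_excess_def by blast+
  obtain C where C: "C \<in> tie_classes G" "card C = class_size" by (rule class_size_attained)
  show "int big_excess \<le> 2 * int n - 4 * int class_size"
    using big_excess_le sum_excess card_edges_le card_tie_classes_le(1)[OF C(1)] C(2) by linarith
qed

text \<open>Equality makes the whole chain behind the cap tight: all other classes are singletons,
  \<open>card E\<close> is \<open>2 (n - class_size)\<close>, and the vertices outside
  \<open>C\<close> have no excess.\<close>

lemma big_excess_maximal: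
  assumes eq: "int big_excess = 2 * int n - 4 * int class_size" and size: "class_size \<ge> 2"
  obtains C where "C \<subseteq> V" "card C = class_size" "(\<Sum>u\<in>C. excess G u) = big_excess"
    "(\<Sum>p\<in>pairs V. tie_weight G p) = pair_min C (excess G)"
    "\<forall>v\<in>V - C. degree G v = 2"
    "\<forall>p\<in>pairs C. tie_weight G p = Min (excess G ` p)"
    "\<forall>e\<in>E. \<exists>u\<in>C. \<exists>v\<in>V - C. ends G e = {u, v}"
proof -
  obtain C where C: "C \<in> tie_classes G" "card C = class_size" by (rule class_size_attained)
  note le = big_excess_le sum_excess card_edges_le card_tie_classes_le(1)[OF C(1)]
  have N: "card (tie_classes G) + card C = n + 1"
    and cE: "card E + 2 = 2 * card (tie_classes G)"
    and ex: "big_excess = (\<Sum>v\<in>V. excess G v)"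
    using le eq C(2) by linarith+
  have big: "big_classes = {C}"
    using C size card_tie_classes_le(2)[OF C(1) N] by (fastforce simp: big_classes_def)
  have exC: "(\<Sum>u\<in>C. excess G u) = big_excess" by (simp add: big_excess_def big)
  have sub: "C \<subseteq> V" using C(1) by (rule tie_classD)
  have "(\<Sum>v\<in>V. excess G v) = (\<Sum>v\<in>V - C. excess G v) + (\<Sum>u\<in>C. excess G u)"
    using sub by (rule sum.subset_diff) simp
  then have "(\<Sum>v\<in>V - C. excess G v) = 0" using ex exC by simp
  then have deg: "degree G v = 2" if "v \<in> V - C" for v
    using that degree_eq by simp
  have cVC: "card (V - C) = n - class_size"
    using sub C(2) finite_subset[OF sub] by (simp add: card_Diff_subset)
  have size_le: "class_size \<le> n" using sub C(2) card_mono[OF finite_V] by metis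
  let ?m = "\<lambda>e. card (ends G e \<inter> (V - C))"
  \<comment> \<open>Edges join untied vertices, so each has an end outside \<open>C\<close>. The
    incidences with \<open>V - C\<close> number \<open>2 (n - class_size)\<close>, which equals
    \<open>card E\<close>: exactly one such end per edge.\<close>
  have not_in: "1 \<le> ?m e" if e: "e \<in> E" for e
  proof (rule ccontr)
    assume "\<not> 1 \<le> ?m e"
    then have "ends G e \<inter> (V - C) = {}" by (simp add: not_le)
    moreover have "ends G e \<subseteq> V" "card (ends G e) = 2" using e mg by (auto simp: multigraph_def)
    ultimately obtain u v where uv: "ends G e = {u, v}" "u \<in> C" "v \<in> C"
      by (auto simp: card_2_iff)
    then show False using edge_untied[OF e uv(1)] tie_classD(4)[OF C(1)] by blast
  qed
  have "(\<Sum>e\<in>E. ?m e) = (\<Sum>e\<in>E. \<Sum>v\<in>V - C. if v \<in> ends G e then 1 else 0)"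
    by (intro sum.cong refl) (simp add: sum.If_cases Int_commute Int_def)
  also have "\<dots> = (\<Sum>v\<in>V - C. \<Sum>e\<in>E. if v \<in> ends G e then 1 else 0)" by (rule sum.swap)
  also have "\<dots> = (\<Sum>v\<in>V - C. degree G v)"
    by (intro sum.cong refl) (simp add: sum.If_cases Int_def degree_def)
  also have "\<dots> = 2 * (n - class_size)" using deg cVC by simp
  also have "\<dots> = card E" using N cE C(2) size_le by linarith
  finally have "(\<Sum>e\<in>E. 1) = (\<Sum>e\<in>E. ?m e)" by simp
  from sum_mono_inv[OF this not_in] have m1: "?m e = 1" if "e \<in> E" for e using that by simp
  have bip: "\<exists>u\<in>C. \<exists>v\<in>V - C. ends G e = {u, v}" if e: "e \<in> E" for e
  proof -
    have c: "ends G e \<subseteq> V" "card (ends G e) = 2" using e mg by (auto simp: multigraph_def)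
    then obtain x y where xy: "ends G e = {x, y}" "x \<noteq> y" by (auto simp: card_2_iff)
    obtain z where z: "ends G e \<inter> (V - C) = {z}" using m1[OF e] by (auto simp: card_1_singleton_iff)
    have m: "t \<in> ends G e \<and> t \<in> V - C \<longleftrightarrow> t = z" for t using z by (metis Int_iff singleton_iff)
    have V: "x \<in> V" "y \<in> V" using c(1) xy(1) by auto
    have "z = x \<or> z = y" using m[of z] xy(1) by auto
    then show ?thesis
    proof
      assume "z = x"
      then have "y \<in> C" "x \<in> V - C" using m[of x] m[of y] xy V by auto
      then show ?thesis using xy(1) by (metis insert_commute)
    next
      assume "z = y"
      then have "x \<in> C" "y \<in> V - C" using m[of x] m[of y] xy V by auto
      then show ?thesis using xy(1) by metis
    qed
  qed
  show ?thesis
  proof (rule that)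
    show "(\<Sum>p\<in>pairs V. tie_weight G p) = pair_min C (excess G)"
      unfolding sum_tie_weight_big big by simp
    show "\<forall>p\<in>pairs C. tie_weight G p = Min (excess G ` p)"
      using C(1) by (auto simp: tie_weight_def)
  qed (use sub C(2) exC deg bip in blast)+
qed

text \<open>\<open>T\<close> bounds twice the weight, which turns the binomial coefficient into
  \<open>n (n - 1)\<close>. At equality the sum of the termwise bounds is attained, so each of them
  is.\<close>

lemma avg_edge_connectivity_le:
  fixes T :: int
  assumes T: "2 * int (\<Sum>p\<in>pairs V. tie_weight G p) \<le> T"
  shows "avg_edge_connectivity G \<le> 2 + real_of_int T / (real n * (real n - 1))"
    and "avg_edge_connectivity G = 2 + real_of_int T / (real n * (real n - 1)) \<Longrightarrow>
      2 * int (\<Sum>p\<in>pairs V. tie_weight G p) = T \<and>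
      (\<forall>p\<in>pairs V. pair_edge_connectivity G p = 2 + tie_weight G p)"
proof -
  let ?L = "\<Sum>p\<in>pairs V. pair_edge_connectivity G p"
  let ?W = "\<Sum>p\<in>pairs V. tie_weight G p"
  define d where "d = real n * (real n - 1)"
  have d: "d > 0" using order_ge_2 by (simp add: d_def)
  have ch: "2 * real (n choose 2) = d"
    using arg_cong[OF two_times_choose_2[of n], of real_of_int] by (simp add: d_def)
  have cp: "2 * real (card (pairs V)) = d" by (simp only: card_pairs finite_V ch)
  have avg: "avg_edge_connectivity G = 2 * real ?L / d"
  proof -
    have "avg_edge_connectivity G = real ?L / real (n choose 2)"
      by (simp add: avg_edge_connectivity_def graph_order_def)
    also have "\<dots> = 2 * real ?L / (2 * real (n choose 2))" by simp
    finally show ?thesis unfolding ch .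
  qed
  have sum2: "(\<Sum>p\<in>pairs V. 2 + tie_weight G p) = 2 * card (pairs V) + ?W"
    by (simp only: sum.distrib sum_constant mult.commute of_nat_id)
  have le: "?L \<le> 2 * card (pairs V) + ?W"
    unfolding sum2[symmetric] by (intro sum_mono pair_edge_connectivity_le)
  then have L: "2 * real ?L \<le> 2 * d + 2 * real ?W" using cp by linarith
  have WT: "2 * real ?W \<le> real_of_int T" using T by linarith
  have iff: "2 * real ?L / d \<le> 2 + real_of_int T / d \<longleftrightarrow> 2 * real ?L \<le> 2 * d + real_of_int T"
    "2 * real ?L / d = 2 + real_of_int T / d \<longleftrightarrow> 2 * real ?L = 2 * d + real_of_int T"
    using d by (simp_all add: field_simps)
  show "avg_edge_connectivity G \<le> 2 + real_of_int T / (real n * (real n - 1))"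
    unfolding avg d_def[symmetric] iff using L WT by linarith
  show "2 * int ?W = T \<and> (\<forall>p\<in>pairs V. pair_edge_connectivity G p = 2 + tie_weight G p)"
    if "avg_edge_connectivity G = 2 + real_of_int T / (real n * (real n - 1))"
  proof -
    have eq: "2 * real ?L = 2 * d + real_of_int T"
      using that unfolding avg d_def[symmetric] iff .
    then have W: "2 * real ?W = real_of_int T" using L WT by linarith
    then have WT': "2 * int ?W = T" by linarith
    have "2 * real ?L = 2 * (2 * real (card (pairs V))) + 2 * real ?W"
      unfolding cp eq W ..
    then have "?L = 2 * card (pairs V) + ?W" by linarith
    then have "?L = (\<Sum>p\<in>pairs V. 2 + tie_weight G p)" using sum2 by simp
    from sum_mono_inv[OF this pair_edge_connectivity_le] WT' show ?thesis by simp
  qed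
qed

end

subsection \<open>Isomorphism and subdivision\<close>

definition iso_pair :: "('v \<Rightarrow> 'w) \<Rightarrow> ('e \<Rightarrow> 'f) \<Rightarrow> ('v, 'e) mgraph \<Rightarrow> ('w, 'f) mgraph \<Rightarrow> bool" where
  "iso_pair f g G K \<longleftrightarrow> bij_betw f (verts G) (verts K) \<and> bij_betw g (edges G) (edges K) \<and>
     (\<forall>e\<in>edges G. ends K (g e) = f ` ends G e)"

lemma iso_pair_inv:
  assumes "multigraph G" "iso_pair f g G K"
  shows "iso_pair (inv_into (verts G) f) (inv_into (edges G) g) K G"
proof -
  have f: "bij_betw f (verts G) (verts K)" and g: "bij_betw g (edges G) (edges K)"
    and e: "\<And>e. e \<in> edges G \<Longrightarrow> ends K (g e) = f ` ends G e"
    using assms(2) by (auto simp: iso_pair_def)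
  have "ends G (inv_into (edges G) g e') = inv_into (verts G) f ` ends K e'" if e': "e' \<in> edges K" for e'
  proof -
    obtain e0 where e0: "e0 \<in> edges G" "e' = g e0" using e' g by (auto simp: bij_betw_def)
    then have "inv_into (edges G) g e' = e0" using g by (auto simp: bij_betw_def)
    moreover have "ends G e0 \<subseteq> verts G" using assms(1) e0 by (auto simp: multigraph_def)
    then have "inv_into (verts G) f ` f ` ends G e0 = ends G e0"
      using f by (simp add: bij_betw_def inv_into_image_cancel)
    ultimately show ?thesis using e0 e by simp
  qed
  then show ?thesis
    using f g by (auto simp: iso_pair_def bij_betw_inv_into)
qed

lemma joined_iso:
  assumes "iso_pair f g G K" "F \<subseteq> edges G" "joined G F u v"
  shows "joined K (g ` F) (f u) (f v)"
  using assms(3)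
proof (induction rule: joined_induct)
  case (step a b e)
  then have "ends K (g e) = {f a, f b}" using assms(1,2) by (auto simp: iso_pair_def)
  then have "joined K (g ` F) (f a) (f b)" using step by (intro joined_edge[of "g e"]) auto
  with step.IH show ?case by (rule joined_trans)
qed simp

text \<open>One transport principle for isomorphisms and for both directions of subdivision:
  \<open>h\<close> acts on whole edge sets and has to keep connection and disjointness.\<close>

lemma packing_map:
  assumes "packing G u v m"
    and "\<And>F. F \<subseteq> edges G \<Longrightarrow> joined G F u v \<Longrightarrow> h F \<subseteq> edges K \<and> joined K (h F) u' v'"
    and "\<And>A B. A \<subseteq> edges G \<Longrightarrow> B \<subseteq> edges G \<Longrightarrow> A \<inter> B = {} \<Longrightarrow> h A \<inter> h B = {}"
  shows "packing K u' v' m"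
proof -
  obtain F where F: "\<And>i. i < m \<Longrightarrow> F i \<subseteq> edges G \<and> joined G (F i) u v"
    and dis: "disjoint_family_on F {..<m}"
    using assms(1) unfolding packing_def by blast
  have "disjoint_family_on (\<lambda>i. h (F i)) {..<m}"
    using F dis assms(3) by (simp add: disjoint_family_on_def)
  then show ?thesis
    unfolding packing_def using F assms(2) by (intro exI[of _ "\<lambda>i. h (F i)"]) simp
qed

lemma packing_iso:
  assumes "iso_pair f g G K" "packing G u v m"
  shows "packing K (f u) (f v) m"
  using assms(2)
proof (rule packing_map)
  fix F assume "F \<subseteq> edges G" "joined G F u v"
  moreover have "g ` edges G = edges K" using assms(1) by (simp add: iso_pair_def bij_betw_def)
  ultimately show "g ` F \<subseteq> edges K \<and> joined K (g ` F) (f u) (f v)"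
    using joined_iso[OF assms(1)] by blast
next
  fix A B assume "A \<subseteq> edges G" "B \<subseteq> edges G" "A \<inter> B = {}"
  moreover have "inj_on g (edges G)" using assms(1) by (simp add: iso_pair_def bij_betw_def)
  ultimately show "g ` A \<inter> g ` B = {}" by (simp flip: inj_on_image_Int)
qed

lemma local_edge_connectivity_iso:
  assumes "multigraph G" "multigraph K" "iso_pair f g G K" "u \<in> verts G" "v \<in> verts G" "u \<noteq> v"
  shows "local_edge_connectivity K (f u) (f v) = local_edge_connectivity G u v"
proof -
  have inj: "inj_on f (verts G)" and im: "f ` verts G = verts K"
    using assms(3) by (auto simp: iso_pair_def bij_betw_def)
  have ne: "f u \<in> verts K" "f u \<noteq> f v" using assms inj im by (auto dest: inj_onD)
  have "packing G u v m" if "packing K (f u) (f v) m" for m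
    using packing_iso[OF iso_pair_inv[OF assms(1,3)] that] inj assms(4,5) by simp
  then have "packing K (f u) (f v) m \<longleftrightarrow> packing G u v m" for m
    using packing_iso[OF assms(3)] by blast
  then have "m \<le> local_edge_connectivity K (f u) (f v) \<longleftrightarrow> m \<le> local_edge_connectivity G u v" for m
    using le_local_edge_connectivity_iff[OF assms(2) ne] le_local_edge_connectivity_iff[OF assms(1,4,6)]
    by simp
  then show ?thesis by (meson order_antisym order_refl)
qed

lemma degree_iso:
  assumes "multigraph G" "iso_pair f g G K" "v \<in> verts G"
  shows "degree K (f v) = degree G v"
proof -
  have f: "inj_on f (verts G)" and g: "inj_on g (edges G)" "g ` edges G = edges K"
    and e: "\<And>e. e \<in> edges G \<Longrightarrow> ends K (g e) = f ` ends G e"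
    using assms(2) by (auto simp: iso_pair_def bij_betw_def)
  have "f v \<in> f ` ends G e \<longleftrightarrow> v \<in> ends G e" if "e \<in> edges G" for e
  proof -
    have "ends G e \<subseteq> verts G" using that assms(1) by (auto simp: multigraph_def)
    then show ?thesis using f assms(3) by (meson inj_on_image_mem_iff)
  qed
  then have "{e \<in> edges K. f v \<in> ends K e} = g ` {e \<in> edges G. v \<in> ends G e}"
    using g(2) e by force
  moreover have "inj_on g {e \<in> edges G. v \<in> ends G e}"
    using g(1) by (rule inj_on_subset) auto
  ultimately show ?thesis by (simp add: degree_def card_image)
qed

lemma subdivision_simps:
  "verts (subdivision H) = Inl ` verts H \<union> Inr ` edges H"
  "edges (subdivision H) = {(e, v). e \<in> edges H \<and> v \<in> ends H e}"
  "ends (subdivision H) (e, v) = {Inr e, Inl v}"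
  by (simp_all add: subdivision_def)

lemma multigraph_subdivision:
  assumes "multigraph H"
  shows "multigraph (subdivision H)"
proof -
  have "{(e, v). e \<in> edges H \<and> v \<in> ends H e} \<subseteq> edges H \<times> verts H"
    using assms by (auto simp: multigraph_def)
  then have "finite {(e, v). e \<in> edges H \<and> v \<in> ends H e}"
    by (rule finite_subset) (use assms in \<open>auto simp: multigraph_def\<close>)
  then show ?thesis
    using assms by (auto simp: multigraph_def subdivision_simps)
qed

lemma degree_subdivision:
  shows "degree (subdivision H) (Inl v) = degree H v"
    and "multigraph H \<Longrightarrow> e \<in> edges H \<Longrightarrow> degree (subdivision H) (Inr e) = 2"
proof -
  have "{x \<in> edges (subdivision H). Inl v \<in> ends (subdivision H) x} = (\<lambda>e. (e, v)) ` {e \<in> edges H. v \<in> ends H e}"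
    by (auto simp: subdivision_simps)
  then show "degree (subdivision H) (Inl v) = degree H v"
    by (simp add: degree_def card_image inj_on_def)
  assume "multigraph H" "e \<in> edges H"
  then have "card (ends H e) = 2" by (auto simp: multigraph_def)
  moreover have "{x \<in> edges (subdivision H). Inr e \<in> ends (subdivision H) x} = Pair e ` ends H e"
    using \<open>e \<in> edges H\<close> by (auto simp: subdivision_simps)
  ultimately show "degree (subdivision H) (Inr e) = 2"
    by (simp add: degree_def card_image inj_on_def)
qed

text \<open>An edge set is sent to all halves of its edges; in the other direction an edge is kept
  if both of its halves are present.\<close>

lemma packing_subdivision:
  assumes mg: "multigraph H"
  shows "packing (subdivision H) (Inl u) (Inl v) m \<longleftrightarrow> packing H u v m"
proof
  let ?S = "subdivision H"
  have two: "\<exists>x y. ends H e = {x, y} \<and> x \<noteq> y" if "e \<in> edges H" for e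
    using that mg by (auto simp: multigraph_def card_2_iff)
  show "packing ?S (Inl u) (Inl v) m" if "packing H u v m"
    using that
  proof (rule packing_map)
    fix F assume F: "F \<subseteq> edges H" "joined H F u v"
    have "joined ?S {(e, x). e \<in> F \<and> x \<in> ends H e} (Inl u) (Inl v)"
      using F(2)
    proof (induction rule: joined_induct)
      case (step a b e)
      let ?F = "{(e, x). e \<in> F \<and> x \<in> ends H e}"
      have "joined ?S ?F (Inl a) (Inr e)"
        using step by (intro joined_edge[of "(e, a)"]) (auto simp: subdivision_simps)
      moreover have "joined ?S ?F (Inr e) (Inl b)"
        using step by (intro joined_edge[of "(e, b)"]) (auto simp: subdivision_simps)
      ultimately show ?case using joined_trans[OF step.IH] joined_trans by fast
    qed simp
    then show "{(e, x). e \<in> F \<and> x \<in> ends H e} \<subseteq> edges ?S \<and>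
        joined ?S {(e, x). e \<in> F \<and> x \<in> ends H e} (Inl u) (Inl v)"
      using F(1) by (auto simp: subdivision_simps)
  qed auto
  show "packing H u v m" if "packing ?S (Inl u) (Inl v) m"
    using that
  proof (rule packing_map)
    fix F assume F: "F \<subseteq> edges ?S" "joined ?S F (Inl u) (Inl v)"
    let ?F = "{e \<in> edges H. \<forall>x\<in>ends H e. (e, x) \<in> F}"
    \<comment> \<open>Invariant at a subdividing vertex \<open>Inr e\<close>: some half
      \<open>(e, x)\<close> in \<open>F\<close> starts at an already reached \<open>x\<close>.
      Leaving towards \<open>x\<close> gives nothing new; leaving by the other half puts
      \<open>e\<close> into the kept set.\<close>
    define P where "P z = (case z of Inl x \<Rightarrow> joined H ?F u x
      | Inr e \<Rightarrow> \<exists>x\<in>ends H e. (e, x) \<in> F \<and> joined H ?F u x)" for z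
    from F(2) have "P (Inl v)"
    proof (induction rule: joined_induct)
      case refl show ?case by (simp add: P_def)
    next
      case (step a b d)
      obtain e y where d: "d = (e, y)" "e \<in> edges H" "y \<in> ends H e"
        using step F(1) by (auto simp: subdivision_simps)
      then have "{a, b} = {Inr e, Inl y}" using step by (simp add: subdivision_simps)
      then consider "a = Inl y" "b = Inr e" | "a = Inr e" "b = Inl y" by (auto simp: doubleton_eq_iff)
      then show ?case
      proof cases
        case 1
        then show ?thesis using step d by (auto simp: P_def)
      next
        case 2
        then obtain x where x: "x \<in> ends H e" "(e, x) \<in> F" "joined H ?F u x"
          using step.IH by (auto simp: P_def)
        show ?thesis
        proof (cases "x = y")
          case True then show ?thesis using x 2 by (simp add: P_def)
        next
          case False
          then have xy: "ends H e = {x, y}" using two[OF d(2)] x(1) d(3) by auto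
          then have "e \<in> ?F" using d x step by auto
          then have "joined H ?F x y" using xy by (rule joined_edge)
          then show ?thesis using joined_trans[OF x(3)] 2 by (simp add: P_def)
        qed
      qed
    qed
    then show "?F \<subseteq> edges H \<and> joined H ?F u v" by (auto simp: P_def)
  next
    fix A B :: "('b \<times> 'a) set" assume "A \<inter> B = {}"
    \<comment> \<open>An edge without ends would be kept vacuously on both sides, so disjointness
      rests on this.\<close>
    moreover have "ends H e \<noteq> {}" if "e \<in> edges H" for e using two[OF that] by auto
    ultimately show "{e \<in> edges H. \<forall>x\<in>ends H e. (e, x) \<in> A} \<inter> {e \<in> edges H. \<forall>x\<in>ends H e. (e, x) \<in> B} = {}"
      by fastforce
  qed
qed

lemma local_edge_connectivity_subdivision:
  assumes "multigraph H" "u \<in> verts H" "u \<noteq> v"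
  shows "local_edge_connectivity (subdivision H) (Inl u) (Inl v) = local_edge_connectivity H u v"
proof -
  have "m \<le> local_edge_connectivity (subdivision H) (Inl u) (Inl v) \<longleftrightarrow> m \<le> local_edge_connectivity H u v" for m
    using assms packing_subdivision[OF assms(1)] le_local_edge_connectivity_iff[OF assms]
      le_local_edge_connectivity_iff[OF multigraph_subdivision[OF assms(1)], of "Inl u" "Inl v"]
    by (simp add: subdivision_simps)
  then show ?thesis by (meson order_antisym order_refl)
qed

lemma isomorphic_iff_iso_pair: "isomorphic G K \<longleftrightarrow> (\<exists>f g. iso_pair f g G K)"
  by (simp add: isomorphic_def iso_pair_def)

lemma nearly_regular_iff:
  assumes "finite (verts H)" "verts H \<noteq> {}"
  shows "nearly_regular H \<longleftrightarrow> (\<forall>u\<in>verts H. \<forall>v\<in>verts H. degree H u \<le> degree H v + 1)"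
proof -
  let ?D = "degree H ` verts H"
  have D: "finite ?D" "?D \<noteq> {}" using assms by auto
  have "nearly_regular H \<longleftrightarrow> Max ?D \<le> Min ?D + 1"
    by (auto simp: nearly_regular_def)
  also have "\<dots> \<longleftrightarrow> (\<forall>x\<in>?D. \<forall>y\<in>?D. x \<le> y + 1)"
  proof
    assume le: "Max ?D \<le> Min ?D + 1"
    show "\<forall>x\<in>?D. \<forall>y\<in>?D. x \<le> y + 1"
    proof (intro ballI)
      fix x y assume "x \<in> ?D" "y \<in> ?D"
      then have "x \<le> Max ?D" "Min ?D \<le> y" using D by auto
      then show "x \<le> y + 1" using le by linarith
    qed
  next
    assume "\<forall>x\<in>?D. \<forall>y\<in>?D. x \<le> y + 1"
    then show "Max ?D \<le> Min ?D + 1" using Max_in[OF D] Min_in[OF D] by blast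
  qed
  also have "\<dots> \<longleftrightarrow> (\<forall>u\<in>verts H. \<forall>v\<in>verts H. degree H u \<le> degree H v + 1)"
    by simp
  finally show ?thesis .
qed

subsection \<open>Extremal graphs\<close>

text \<open>Near regularity excludes a degree above \<open>d\<close> together with one below
  \<open>d\<close>. All degrees then lie on one side of their average \<open>d\<close>, hence equal
  it.\<close>

lemma nearly_regular_imp_regular:
  assumes mg: "multigraph H" and nr: "nearly_regular H" and ne: "verts H \<noteq> {}"
    and size: "2 * graph_size H = d * graph_order H"
  shows "regular d H"
proof -
  have fin: "finite (verts H)" using mg by (simp add: multigraph_def)
  have near: "degree H u \<le> degree H v + 1" if "u \<in> verts H" "v \<in> verts H" for u v
    using that nr nearly_regular_iff[OF fin ne] by blast
  have sum: "(\<Sum>v\<in>verts H. degree H v) = (\<Sum>v\<in>verts H. d)"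
    using sum_degree[OF mg] size by (simp add: graph_size_def graph_order_def)
  have "degree H v = d" if v: "v \<in> verts H" for v
  proof -
    consider "\<forall>u\<in>verts H. degree H u \<le> d" | "\<forall>u\<in>verts H. d \<le> degree H u"
      using near by (metis Suc_eq_plus1 not_less_eq_eq not_less_eq order_trans nat_le_linear)
    then show ?thesis
    proof cases
      case 1
      then show ?thesis using sum_mono_inv[OF sum _ v fin] by simp
    next
      case 2
      then show ?thesis using sum_mono_inv[OF sum[symmetric] _ v fin] by simp
    qed
  qed
  then show ?thesis by (simp add: regular_def)
qed

context min_2_edge_connected
begin

lemma avg_edge_connectivity_eq:
  assumes \<omega>: "\<And>p. p \<in> pairs V \<Longrightarrow> pair_edge_connectivity G p = 2 + \<omega> p"
    and T: "2 * int (\<Sum>p\<in>pairs V. \<omega> p) = T"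
  shows "avg_edge_connectivity G = 2 + real_of_int T / (real n * (real n - 1))"
proof -
  let ?c = "real (n choose 2)"
  have c: "?c > 0" using order_ge_2 by simp
  have ch: "2 * ?c = real n * (real n - 1)"
    using arg_cong[OF two_times_choose_2[of n], of real_of_int] by simp
  have "(\<Sum>p\<in>pairs V. pair_edge_connectivity G p) = (\<Sum>p\<in>pairs V. 2 + \<omega> p)"
    by (rule sum.cong) (use \<omega> in auto)
  also have "\<dots> = 2 * (n choose 2) + (\<Sum>p\<in>pairs V. \<omega> p)"
    by (simp only: sum.distrib sum_constant mult.commute of_nat_id card_pairs finite_V)
  finally have "real (\<Sum>p\<in>pairs V. pair_edge_connectivity G p) = 2 * ?c + real_of_int T / 2"
    using T by linarith
  then have "avg_edge_connectivity G = (2 * ?c + real_of_int T / 2) / ?c"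
    by (simp add: avg_edge_connectivity_def graph_order_def)
  also have "\<dots> = 2 + real_of_int T / (2 * ?c)" using c by (simp add: field_simps)
  finally show ?thesis unfolding ch .
qed

text \<open>With \<open>C\<close> the original vertices, \<open>card (edges H) = n - s\<close>, so
  the excess on \<open>C\<close> sums to \<open>2 (n - s) - 2 s\<close>. Near regularity makes the
  sum of minima equal to \<open>fill\<close>, and ideality realizes every minimum.\<close>

lemma obtained_by_subdividing_imp:
  assumes "obtained_by_subdividing G Q"
    and Q: "\<And>H. multigraph H \<Longrightarrow> Q H \<Longrightarrow> ideally_edge_connected H \<and> nearly_regular H \<and> S (graph_order H)"
    and S: "\<And>s. S s \<Longrightarrow> s > 0 \<and> fill (int s) (2 * int n - 4 * int s) = T"
  shows "avg_edge_connectivity G = 2 + real_of_int T / (real n * (real n - 1))"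
proof -
  obtain H f g where mH: "multigraph H" and QH: "Q H" and iso: "iso_pair f g G (subdivision H)"
    using assms(1) unfolding obtained_by_subdividing_def isomorphic_iff_iso_pair by blast
  define s where "s = graph_order H"
  have ideal: "ideally_edge_connected H" and nr: "nearly_regular H" and Ss: "S s"
    using Q[OF mH QH] by (auto simp: s_def)
  have fs: "s > 0" "fill (int s) (2 * int n - 4 * int s) = T" using S[OF Ss] by auto
  have finH: "finite (verts H)" "finite (edges H)" using mH by (auto simp: multigraph_def)
  have neH: "verts H \<noteq> {}" using fs(1) by (auto simp: s_def graph_order_def)
  have f: "inj_on f V" "f ` V = Inl ` verts H \<union> Inr ` edges H"
    using iso by (auto simp: iso_pair_def bij_betw_def subdivision_simps)
  have mS: "multigraph (subdivision H)" using mH by (rule multigraph_subdivision)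
  define C where "C = {x \<in> V. f x \<in> Inl ` verts H}"
  define h where "h x = projl (f x)" for x
  have h: "f x = Inl (h x)" "h x \<in> verts H" if "x \<in> C" for x
    using that by (auto simp: C_def h_def)
  have bij: "bij_betw h C (verts H)"
  proof (rule bij_betw_imageI)
    show "inj_on h C"
    proof (rule inj_onI)
      fix x y assume xy: "x \<in> C" "y \<in> C" "h x = h y"
      then have "f x = f y" using h(1)[OF xy(1)] h(1)[OF xy(2)] by simp
      moreover have "x \<in> V" "y \<in> V" using xy(1,2) by (simp_all add: C_def)
      ultimately show "x = y" using f(1) by (auto dest: inj_onD)
    qed
    show "h ` C = verts H"
    proof
      show "verts H \<subseteq> h ` C"
      proof
        fix u assume u: "u \<in> verts H"
        then have "Inl u \<in> f ` V" using f(2) by simp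
        then obtain x where "x \<in> V" "f x = Inl u" by auto
        then have "x \<in> C" "h x = u" using u by (auto simp: C_def h_def)
        then show "u \<in> h ` C" by blast
      qed
    qed (use h in auto)
  qed
  have sub: "C \<subseteq> V" by (auto simp: C_def)
  have finC: "finite C" using sub finite_V finite_subset by blast
  have cC: "card C = s" using bij by (simp add: bij_betw_same_card s_def graph_order_def)
  have "n = card (f ` V)" using f(1) by (simp add: card_image)
  also have "\<dots> = s + card (edges H)"
    unfolding f(2) using finH by (subst card_Un_disjoint) (auto simp: card_image s_def graph_order_def)
  finally have n: "n = s + card (edges H)" .
  have degC: "degree G x = degree H (h x)" if "x \<in> C" for x
    using degree_iso[OF mg iso, of x] h(1)[OF that] degree_subdivision(1)[of H "h x"] that sub by auto
  have degO: "degree G x = 2" if x: "x \<in> V - C" for x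
  proof -
    have "f x \<in> f ` V" using x by blast
    then obtain e where "e \<in> edges H" "f x = Inr e" using x unfolding f(2) C_def by blast
    then show ?thesis using degree_iso[OF mg iso, of x] x degree_subdivision(2)[OF mH] by simp
  qed
  have "(\<Sum>x\<in>C. degree G x) = (\<Sum>x\<in>C. degree H (h x))" by (intro sum.cong refl degC)
  also have "\<dots> = (\<Sum>v\<in>verts H. degree H v)" using bij by (rule sum.reindex_bij_betw)
  also have "\<dots> = 2 * card (edges H)" using mH by (rule sum_degree)
  finally have "(\<Sum>x\<in>C. 2 + excess G x) = 2 * card (edges H)"
    using sub degree_eq by (simp add: subset_eq)
  moreover have "(\<Sum>x\<in>C. 2 + excess G x) = 2 * s + (\<Sum>x\<in>C. excess G x)"
    by (simp only: sum.distrib sum_constant mult.commute of_nat_id cC)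
  ultimately have ex: "int (\<Sum>x\<in>C. excess G x) = 2 * int n - 4 * int s" using n by linarith
  have "degree H u \<le> degree H v + 1" if "u \<in> verts H" "v \<in> verts H" for u v
    using that nr nearly_regular_iff[OF finH(1) neH] by blast
  then have "excess G x \<le> excess G y + 1" if "x \<in> C" "y \<in> C" for x y
    using that h(2) degC by (force simp: excess_def)
  moreover have "C \<noteq> {}" using cC fs(1) by auto
  ultimately have pm: "2 * int (pair_min C (excess G)) = T"
    using pair_min_nearly_regular[OF finC, of "excess G"] cC ex fs(2) by simp
  \<comment> \<open>The weight is defined from \<open>C\<close> itself rather than from tie classes;
    a pair not inside \<open>C\<close> has a vertex of degree 2 and so connectivity exactly
    2.\<close>
  define \<omega> where "\<omega> p = (if p \<subseteq> C then Min (excess G ` p) else 0)" for p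
  have "(\<Sum>p\<in>pairs V. \<omega> p) = (\<Sum>p\<in>pairs C. \<omega> p)"
    using sub by (intro sum.mono_neutral_right) (auto simp: \<omega>_def)
  also have "\<dots> = pair_min C (excess G)"
    unfolding pair_min_def by (intro sum.cong refl) (simp add: \<omega>_def)
  finally have "2 * int (\<Sum>p\<in>pairs V. \<omega> p) = T" using pm by simp
  then show ?thesis
  proof (rule avg_edge_connectivity_eq[rotated])
    fix p assume "p \<in> pairs V"
    then obtain x y where p: "p = {x, y}" "x \<noteq> y" "x \<in> V" "y \<in> V" by (rule pairE)
    show "pair_edge_connectivity G p = 2 + \<omega> p"
    proof (cases "x \<in> C \<and> y \<in> C")
      case True
      have "h x \<noteq> h y" using True p(2) bij by (auto simp: bij_betw_def dest: inj_onD)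
      then have "local_edge_connectivity G x y = min (degree H (h x)) (degree H (h y))"
        using local_edge_connectivity_iso[OF mg mS iso p(3,4,2)] True h
          local_edge_connectivity_subdivision[OF mH, of "h x" "h y"] ideal
        by (simp add: ideally_edge_connected_def)
      also have "\<dots> = 2 + min (excess G x) (excess G y)"
        using degC[of x] degC[of y] degree_eq[OF p(3)] degree_eq[OF p(4)] True by simp
      finally show ?thesis using True p(1) by (simp add: \<omega>_def)
    next
      case False
      then have "degree G x = 2 \<or> degree G y = 2" using degO p by blast
      then have "local_edge_connectivity G x y \<le> 2"
        using local_edge_connectivity_le_degree[OF mg p(3,4,2)] by auto
      then show ?thesis
        using local_edge_connectivity_ge_2[OF p(3,4,2)] False p(1) by (auto simp: \<omega>_def)
    qed
  qed
qed

text \<open>The vertices outside \<open>C\<close> become the edges of \<open>H\<close>, each joining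
  its two neighbours in \<open>C\<close>; subdividing them restores \<open>G\<close>.\<close>

lemma obtained_by_subdividingI:
  assumes sub: "C \<subseteq> V" and two: "card C \<ge> 2"
    and deg: "\<And>v. v \<in> V - C \<Longrightarrow> degree G v = 2"
    and bip: "\<And>e. e \<in> E \<Longrightarrow> \<exists>u\<in>C. \<exists>v\<in>V - C. ends G e = {u, v}"
    and near: "\<And>u v. u \<in> C \<Longrightarrow> v \<in> C \<Longrightarrow> degree G u \<le> degree G v + 1"
    and conn: "\<And>u v. u \<in> C \<Longrightarrow> v \<in> C \<Longrightarrow> u \<noteq> v \<Longrightarrow>
      local_edge_connectivity G u v = min (degree G u) (degree G v)"
  obtains H :: "(nat, nat) mgraph" where "multigraph H" "ideally_edge_connected H" "nearly_regular H"
    "graph_order H = card C" "graph_order H + graph_size H = n" "isomorphic G (subdivision H)"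
proof -
  have finC: "finite C" using sub finite_V finite_subset by blast
  \<comment> \<open>\<open>b e\<close> is the end in \<open>C\<close>, which becomes a vertex of
    \<open>H\<close>; \<open>w e\<close> is the end of degree 2, which becomes an edge.\<close>
  obtain b w where bw: "\<And>e. e \<in> E \<Longrightarrow> b e \<in> C \<and> w e \<in> V - C \<and> ends G e = {b e, w e}"
    using bip by metis
  have at_w: "x \<in> ends G e \<longleftrightarrow> w e = x" if "e \<in> E" "x \<in> V - C" for e x
    using bw[OF that(1)] that(2) by auto
  have at_b: "x \<in> ends G e \<longleftrightarrow> b e = x" if "e \<in> E" "x \<in> C" for e x
    using bw[OF that(1)] that(2) by auto
  \<comment> \<open>Two parallel edges at a vertex of degree 2 would become a loop of \<open>H\<close>: cutting around them
    would bring the connectivity at \<open>b e\<close> down to its degree minus 2.\<close>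
  have inj: "e = e'" if e: "e \<in> E" "e' \<in> E" "b e = b e'" "w e = w e'" for e e'
  proof (rule ccontr)
    assume ne: "e \<noteq> e'"
    define u where "u = b e"
    define x where "x = w e"
    have u: "u \<in> C" and x: "x \<in> V - C" using bw[OF e(1)] by (auto simp: u_def x_def)
    have "card {e, e'} = card {d \<in> E. x \<in> ends G d}"
      using ne deg[OF x] by (simp add: degree_def)
    moreover have "{e, e'} \<subseteq> {d \<in> E. x \<in> ends G d}"
      using bw e by (auto simp: x_def)
    ultimately have atx: "{d \<in> E. x \<in> ends G d} = {e, e'}"
      using card_subset_eq[of "{d \<in> E. x \<in> ends G d}" "{e, e'}"] by simp
    have cut: "cut_edges G {u, x} \<subseteq> {d \<in> E. u \<in> ends G d} - {e, e'}"
    proof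
      fix d assume d: "d \<in> cut_edges G {u, x}"
      have "d \<noteq> e" "d \<noteq> e'" using d bw[OF e(1)] bw[OF e(2)] e(3,4) by (auto simp: cut_edges_def u_def x_def)
      then have "x \<notin> ends G d" using atx d by (auto simp: cut_edges_def)
      then show "d \<in> {d \<in> E. u \<in> ends G d} - {e, e'}"
        using d \<open>d \<noteq> e\<close> \<open>d \<noteq> e'\<close> by (auto simp: cut_edges_def)
    qed
    have "{e, e'} \<subseteq> {d \<in> E. u \<in> ends G d}" using bw e by (auto simp: u_def)
    then have "card ({d \<in> E. u \<in> ends G d} - {e, e'}) = degree G u - 2"
      using ne by (subst card_Diff_subset) (auto simp: degree_def)
    then have c: "card (cut_edges G {u, x}) \<le> degree G u - 2"
      using card_mono[OF _ cut] by simp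
    obtain v where v: "v \<in> C" "v \<noteq> u"
    proof -
      have "\<not> C \<subseteq> {u}" using two card_mono[of "{u}" C] by auto
      then show ?thesis using that by blast
    qed
    have "u \<in> V" "v \<notin> {u, x}" using u sub v x by auto
    then have "min (degree G u) (degree G v) \<le> degree G u - 2"
      using local_edge_connectivity_le_card_cut_edges[OF mg, of u "{u, x}" v] conn[of u v] u v c by simp
    moreover have "2 \<le> degree G u" using \<open>u \<in> V\<close> by (rule degree_ge_2)
    \<comment> \<open>The minimum has to be \<open>degree G v\<close>, so the degrees of
      \<open>u\<close> and \<open>v\<close> would differ by at least 2.\<close>
    ultimately show False using near[OF u v(1)] by linarith
  qed
  \<comment> \<open>One injection numbers both the vertices and the edges of \<open>H\<close>, since
    \<open>obtained_by_subdividing\<close> asks for a graph over \<open>nat\<close>.\<close>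
  obtain \<alpha> :: "'v \<Rightarrow> nat" where \<alpha>: "inj_on \<alpha> V"
    using finite_imp_inj_to_nat_seg[OF finite_V] by blast
  define N where "N x = b ` {e \<in> E. w e = x}" for x
  define H where "H = \<lparr>verts = \<alpha> ` C, edges = \<alpha> ` (V - C), ends = (\<lambda>i. \<alpha> ` N (inv_into V \<alpha> i))\<rparr>"
  have H: "verts H = \<alpha> ` C" "edges H = \<alpha> ` (V - C)" "\<And>x. x \<in> V \<Longrightarrow> ends H (\<alpha> x) = \<alpha> ` N x"
    using \<alpha> by (simp_all add: H_def)
  have N: "N x \<subseteq> C" "card (N x) = 2" if x: "x \<in> V - C" for x
  proof -
    show "N x \<subseteq> C" using bw by (auto simp: N_def)
    have "inj_on b {e \<in> E. w e = x}" using inj by (auto intro: inj_onI)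
    moreover have "{e \<in> E. w e = x} = {e \<in> E. x \<in> ends G e}" using at_w x by blast
    ultimately show "card (N x) = 2" using deg[OF x] by (simp add: N_def card_image degree_def)
  qed
  have \<alpha>C: "inj_on \<alpha> C" using \<alpha> sub by (rule inj_on_subset)
  have \<alpha>V: "inj_on \<alpha> (V - C)" using \<alpha> by (rule inj_on_subset) auto
  have mH: "multigraph H"
    unfolding multigraph_def
  proof (intro conjI ballI)
    fix i assume "i \<in> edges H"
    then obtain x where x: "x \<in> V - C" "i = \<alpha> x" using H by auto
    then have "ends H i = \<alpha> ` N x" using H(3) by simp
    then show "ends H i \<subseteq> verts H" "card (ends H i) = 2"
      using H(1) N[OF x(1)] inj_on_subset[OF \<alpha>C N(1)[OF x(1)]] by (auto simp: card_image)
  qed (use H finC in auto)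
  define f where "f x = (if x \<in> C then Inl (\<alpha> x) else Inr (\<alpha> x))" for x
  define g where "g e = (\<alpha> (w e), \<alpha> (b e))" for e
  have iso: "iso_pair f g G (subdivision H)"
    unfolding iso_pair_def
  proof (intro conjI ballI bij_betw_imageI)
    show "inj_on f V" using \<alpha> by (auto simp: inj_on_def f_def split: if_splits)
    show "f ` V = verts (subdivision H)" using sub by (auto simp: f_def subdivision_simps H)
    show "inj_on g E"
    proof (rule inj_onI)
      fix e e' assume e: "e \<in> E" "e' \<in> E" "g e = g e'"
      have "w e \<in> V" "w e' \<in> V" "b e \<in> V" "b e' \<in> V" using bw[OF e(1)] bw[OF e(2)] sub by auto
      then have "b e = b e'" "w e = w e'" using e(3) \<alpha> by (auto simp: g_def dest: inj_onD)
      then show "e = e'" using inj e by blast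
    qed
    show "g ` E = edges (subdivision H)"
    proof
      show "g ` E \<subseteq> edges (subdivision H)"
      proof
        fix d assume "d \<in> g ` E"
        then obtain e where e: "e \<in> E" "d = g e" by blast
        have "w e \<in> V - C" "b e \<in> N (w e)" using bw[OF e(1)] e(1) by (auto simp: N_def)
        then show "d \<in> edges (subdivision H)"
          using H e by (auto simp: g_def subdivision_simps)
      qed
      show "edges (subdivision H) \<subseteq> g ` E"
      proof
        fix d assume "d \<in> edges (subdivision H)"
        then obtain x y where x: "x \<in> V - C" "y \<in> ends H (\<alpha> x)" "d = (\<alpha> x, y)"
          using H by (auto simp: subdivision_simps)
        then have "y \<in> \<alpha> ` N x" using H by simp
        then obtain e where "e \<in> E" "w e = x" "y = \<alpha> (b e)" by (auto simp: N_def)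
        then show "d \<in> g ` E" using x by (auto simp: g_def)
      qed
    qed
    fix e assume e: "e \<in> E"
    then have "b e \<in> C" "w e \<notin> C" "ends G e = {b e, w e}" using bw by auto
    then show "ends (subdivision H) (g e) = f ` ends G e"
      by (simp add: g_def f_def subdivision_simps insert_commute)
  qed
  have fC: "f u = Inl (\<alpha> u)" if "u \<in> C" for u using that by (simp add: f_def)
  have degH: "degree H (\<alpha> u) = degree G u" if u: "u \<in> C" for u
    using degree_iso[OF mg iso, of u] degree_subdivision(1)[of H "\<alpha> u"] fC[OF u] u sub by auto
  have connH: "local_edge_connectivity H (\<alpha> u) (\<alpha> v) = local_edge_connectivity G u v"
    if uv: "u \<in> C" "v \<in> C" "u \<noteq> v" for u v
  proof -
    have "\<alpha> u \<in> verts H" "\<alpha> u \<noteq> \<alpha> v" using uv H \<alpha>C by (auto dest: inj_onD)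
    from local_edge_connectivity_subdivision[OF mH this]
    show ?thesis
      using local_edge_connectivity_iso[OF mg multigraph_subdivision[OF mH] iso, of u v] fC uv sub by auto
  qed
  show ?thesis
  proof (rule that[OF mH])
    show "ideally_edge_connected H"
      using connH degH conn by (auto simp: ideally_edge_connected_def H)
    have "verts H \<noteq> {}" using two H by auto
    then show "nearly_regular H"
      using nearly_regular_iff[of H] near degH finC by (simp add: H)
    show ord: "graph_order H = card C" using \<alpha>C by (simp add: graph_order_def H card_image)
    have "graph_size H = n - card C"
      using \<alpha>V sub finC by (simp add: graph_size_def H card_image card_Diff_subset)
    then show "graph_order H + graph_size H = n" using ord card_mono[OF finite_V sub] by simp
    show "isomorphic G (subdivision H)" using iso isomorphic_iff_iso_pair by blast
  qed
qed

text \<open>Common frame for the four residues: \<open>S\<close> describes the optimal class sizes,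
  a single one except for residue 2, and \<open>Q\<close> is the property of \<open>H\<close> in the
  wording of the theorem. Order and size of \<open>H\<close> add up to \<open>n\<close> because each
  edge of \<open>H\<close> becomes a vertex of \<open>G\<close>.\<close>

lemma avg_edge_connectivity_extremal:
  fixes T :: int
  defines "w \<equiv> 2 * int (\<Sum>p\<in>pairs V. tie_weight G p)"
  assumes T: "w \<le> T"
    and eqT: "w = T \<Longrightarrow> S class_size \<and> int big_excess = 2 * int n - 4 * int class_size"
    and S: "\<And>s. S s \<Longrightarrow> s \<ge> 2 \<and> fill (int s) (2 * int n - 4 * int s) = T"
    and Q1: "\<And>H. multigraph H \<Longrightarrow> Q H \<Longrightarrow>
      ideally_edge_connected H \<and> nearly_regular H \<and> S (graph_order H)"
    and Q2: "\<And>H. multigraph H \<Longrightarrow> ideally_edge_connected H \<Longrightarrow> nearly_regular H \<Longrightarrow>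
      S (graph_order H) \<Longrightarrow> graph_order H + graph_size H = n \<Longrightarrow> Q H"
  shows "avg_edge_connectivity G \<le> 2 + real_of_int T / (real n * (real n - 1)) \<and>
    (avg_edge_connectivity G = 2 + real_of_int T / (real n * (real n - 1)) \<longleftrightarrow>
      obtained_by_subdividing G Q)"
proof (intro conjI iffI)
  show "avg_edge_connectivity G \<le> 2 + real_of_int T / (real n * (real n - 1))"
    using avg_edge_connectivity_le(1) T by (simp add: w_def)
next
  assume "obtained_by_subdividing G Q"
  then show "avg_edge_connectivity G = 2 + real_of_int T / (real n * (real n - 1))"
    by (rule obtained_by_subdividing_imp[where S = S]) (use Q1 S in force)+
next
  assume "avg_edge_connectivity G = 2 + real_of_int T / (real n * (real n - 1))"
  then have wT: "w = T" and conn: "\<And>p. p \<in> pairs V \<Longrightarrow> pair_edge_connectivity G p = 2 + tie_weight G p"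
    using avg_edge_connectivity_le(2)[of T] T by (auto simp: w_def)
  have Ss: "S class_size" and ex: "int big_excess = 2 * int n - 4 * int class_size"
    using eqT[OF wT] by auto
  have two: "class_size \<ge> 2" and fT: "fill (int class_size) (2 * int n - 4 * int class_size) = T"
    using S[OF Ss] by auto
  obtain C where C: "C \<subseteq> V" "card C = class_size" "(\<Sum>u\<in>C. excess G u) = big_excess"
    "(\<Sum>p\<in>pairs V. tie_weight G p) = pair_min C (excess G)"
    "\<forall>v\<in>V - C. degree G v = 2"
    "\<forall>p\<in>pairs C. tie_weight G p = Min (excess G ` p)"
    "\<forall>e\<in>E. \<exists>u\<in>C. \<exists>v\<in>V - C. ends G e = {u, v}"
    by (rule big_excess_maximal[OF ex two])
  have finC: "finite C" using C(1) finite_V finite_subset by blast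
  have "2 * int (pair_min C (excess G)) = fill (int (card C)) (int (\<Sum>u\<in>C. excess G u))"
    unfolding C(2,3) ex fT using wT C(4) by (simp add: w_def)
  from pair_min_eq_fill_imp[OF finC this]
  have near: "excess G u \<le> excess G v + 1" if "u \<in> C" "v \<in> C" for u v using that by blast
  have degC: "degree G u = 2 + excess G u" if "u \<in> C" for u using that C(1) degree_eq by blast
  obtain H :: "(nat, nat) mgraph" where H: "multigraph H" "ideally_edge_connected H" "nearly_regular H"
    "graph_order H = card C" "graph_order H + graph_size H = n" "isomorphic G (subdivision H)"
  proof (rule obtained_by_subdividingI[OF C(1) _ bspec[OF C(5)] bspec[OF C(7)]])
    show "card C \<ge> 2" using two C(2) by simp
    show "degree G u \<le> degree G v + 1" if "u \<in> C" "v \<in> C" for u v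
      using near[OF that] degC that by simp
    show "local_edge_connectivity G u v = min (degree G u) (degree G v)"
      if uv: "u \<in> C" "v \<in> C" "u \<noteq> v" for u v
    proof -
      have "{u, v} \<in> pairs V" "{u, v} \<in> pairs C" using uv C(1) by auto
      then show ?thesis using conn[of "{u, v}"] bspec[OF C(6), of "{u, v}"] degC uv by simp
    qed
  qed
  then have "Q H" using Q2 Ss C(2) by simp
  then show "obtained_by_subdividing G Q"
    using H unfolding obtained_by_subdividing_def by blast
qed

end

text \<open>\<open>T\<close> is measured over \<open>n (n - 1)\<close>, the numerators of the
  theorem over \<open>4 n (n - 1)\<close>; hence the factor 4.\<close>

lemma (in min_2_edge_connected) avg_edge_connectivity_extremal_div:
  fixes T :: int and X :: real
  defines "w \<equiv> 2 * int (\<Sum>p\<in>pairs V. tie_weight G p)"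
  assumes X: "X = 4 * real_of_int T"
    and T: "w \<le> T"
    and eqT: "w = T \<Longrightarrow> S class_size \<and> int big_excess = 2 * int n - 4 * int class_size"
    and S: "\<And>s. S s \<Longrightarrow> s \<ge> 2 \<and> fill (int s) (2 * int n - 4 * int s) = T"
    and Q1: "\<And>H. multigraph H \<Longrightarrow> Q H \<Longrightarrow>
      ideally_edge_connected H \<and> nearly_regular H \<and> S (graph_order H)"
    and Q2: "\<And>H. multigraph H \<Longrightarrow> ideally_edge_connected H \<Longrightarrow> nearly_regular H \<Longrightarrow>
      S (graph_order H) \<Longrightarrow> graph_order H + graph_size H = n \<Longrightarrow> Q H"
  shows "avg_edge_connectivity G \<le> 2 + X / (4 * real n * (real n - 1)) \<and>
    (avg_edge_connectivity G = 2 + X / (4 * real n * (real n - 1)) \<longleftrightarrow>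
      obtained_by_subdividing G Q)"
proof -
  have "X / (4 * real n * (real n - 1)) = real_of_int T / (real n * (real n - 1))"
    unfolding X mult.assoc by (rule mult_divide_mult_cancel_left) simp
  then show ?thesis
    using avg_edge_connectivity_extremal[OF T[unfolded w_def] eqT[unfolded w_def] S Q1 Q2] by simp
qed

theorem theorem3p16:
  fixes G :: "('v, 'e) mgraph" and n :: nat
  assumes "multigraph G"
    and "minimally_2_edge_connected G"
    and "graph_order G = n"
  shows "avg_edge_connectivity G \<le> 2 + (real n - 2)^2 / (4 * real n * (real n - 1))
    \<and> 2 + (real n - 2)^2 / (4 * real n * (real n - 1)) < 9 / 4
    \<and> (\<forall>k l :: nat. n = 4 * k + l \<and> l < 4 \<longrightarrow>
      (k \<ge> 8 \<and> l = 0 \<longrightarrow>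
         avg_edge_connectivity G
           \<le> 2 + ((real n)^2 - 4 * real n) / (4 * real n * (real n - 1))
         \<and> (avg_edge_connectivity G
              = 2 + ((real n)^2 - 4 * real n) / (4 * real n * (real n - 1))
            \<longleftrightarrow> obtained_by_subdividing G (\<lambda>H. ideally_edge_connected H \<and> regular 6 H
                  \<and> graph_order H = k)))
    \<and> (k \<ge> 30 \<and> l = 1 \<longrightarrow>
         avg_edge_connectivity G
           \<le> 2 + ((real n)^2 - 6 * real n + 13) / (4 * real n * (real n - 1))
         \<and> (avg_edge_connectivity G
              = 2 + ((real n)^2 - 6 * real n + 13) / (4 * real n * (real n - 1))
            \<longleftrightarrow> obtained_by_subdividing G (\<lambda>H. ideally_edge_connected H \<and> nearly_regular H
                  \<and> graph_order H = k \<and> graph_size H = n - k)))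
    \<and> (k \<ge> 68 \<and> l = 2 \<longrightarrow>
         avg_edge_connectivity G
           \<le> 2 + ((real n)^2 - 8 * real n + 60) / (4 * real n * (real n - 1))
         \<and> (avg_edge_connectivity G
              = 2 + ((real n)^2 - 8 * real n + 60) / (4 * real n * (real n - 1))
            \<longleftrightarrow> obtained_by_subdividing G (\<lambda>H. ideally_edge_connected H \<and> nearly_regular H
                  \<and> (graph_order H = k \<and> graph_size H = n - k
                     \<or> graph_order H = k + 1 \<and> graph_size H = n - k - 1))))
    \<and> (k \<ge> 30 \<and> l = 3 \<longrightarrow>
         avg_edge_connectivity G
           \<le> 2 + ((real n)^2 - 6 * real n + 17) / (4 * real n * (real n - 1))
         \<and> (avg_edge_connectivity G
              = 2 + ((real n)^2 - 6 * real n + 17) / (4 * real n * (real n - 1))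
            \<longleftrightarrow> obtained_by_subdividing G (\<lambda>H. ideally_edge_connected H \<and> nearly_regular H
                  \<and> graph_order H = k + 1 \<and> graph_size H = n - k - 1))))"
proof -
  interpret min_2_edge_connected G by unfold_locales (use assms in auto)
  have n: "card (verts G) = n" using assms(3) by (simp add: graph_order_def)
  have n2: "n \<ge> 2" using order_ge_2 n by simp
  note wb = weight_bounds[unfolded n]
  have size: "int class_size > 0" using class_size_pos by simp
  note numeric = wb(1,2,3) size
  note extremal = avg_edge_connectivity_extremal_div[unfolded n]
  have general: "avg_edge_connectivity G \<le> 2 + (real n - 2)^2 / (4 * real n * (real n - 1))"
  proof -
    define w where "w = 2 * int (\<Sum>p\<in>pairs (verts G). tie_weight G p)"
    define s where "s = int class_size"
    have "w \<le> (s - 1) * (2 * int n - 4 * s)"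
      using linear_bound[OF numeric] by (simp only: w_def s_def)
    \<comment> \<open>Completing the square around the peak \<open>s = (n + 2) / 4\<close>.\<close>
    moreover have "4 * ((s - 1) * (2 * int n - 4 * s)) = (int n - 2)^2 - (int n - 4 * s + 2)^2"
      by (simp add: algebra_simps power2_eq_square)
    moreover have "0 \<le> (int n - 4 * s + 2)^2" by simp
    ultimately have "4 * w \<le> (int n - 2)^2" by linarith
    then have "real_of_int (4 * w) \<le> real_of_int ((int n - 2)^2)" by (simp only: of_int_le_iff)
    then have w4: "4 * real_of_int w \<le> (real n - 2)^2" by simp
    have "avg_edge_connectivity G \<le> 2 + real_of_int w / (real n * (real n - 1))"
      by (rule avg_edge_connectivity_le(1)[unfolded n]) (simp add: w_def)
    also have "real_of_int w / (real n * (real n - 1)) = 4 * real_of_int w / (4 * real n * (real n - 1))"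
      unfolding mult.assoc by (rule mult_divide_mult_cancel_left[symmetric]) simp
    also have "\<dots> \<le> (real n - 2)^2 / (4 * real n * (real n - 1))"
      using w4 n2 by (intro divide_right_mono) auto
    finally show ?thesis by simp
  qed
  have less: "2 + (real n - 2)^2 / (4 * real n * (real n - 1)) < 9 / 4"
  proof -
    have "(real n - 2)^2 < real n * (real n - 1)"
      using n2 by (simp add: power2_eq_square algebra_simps)
    moreover have "2 + X / (4 * P) < 9 / 4" if "X < P" "P > 0" for X P :: real
      using that by (simp add: field_simps)
    ultimately show ?thesis using n2 by (simp add: mult.assoc)
  qed
  have a: "avg_edge_connectivity G \<le> 2 + ((real n)^2 - 4 * real n) / (4 * real n * (real n - 1))
         \<and> (avg_edge_connectivity G
              = 2 + ((real n)^2 - 4 * real n) / (4 * real n * (real n - 1))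
            \<longleftrightarrow> obtained_by_subdividing G (\<lambda>H. ideally_edge_connected H \<and> regular 6 H
                  \<and> graph_order H = k))" (is "?A k")
    if k: "n = 4 * k" "k \<ge> 8" for k
  proof (rule extremal[where T = "4 * (int k)^2 - 4 * int k" and S = "\<lambda>s. s = k"])
    note b = bound_mod4_0[OF numeric, of "int k"]
    show "(real n)^2 - 4 * real n = 4 * real_of_int (4 * (int k)^2 - 4 * int k)"
      using k by (simp add: power2_eq_square algebra_simps)
    show "2 * int (\<Sum>p\<in>pairs (verts G). tie_weight G p) \<le> 4 * (int k)^2 - 4 * int k"
      using b k by simp
    show "class_size = k \<and> int big_excess = 2 * int n - 4 * int class_size"
      if "2 * int (\<Sum>p\<in>pairs (verts G). tie_weight G p) = 4 * (int k)^2 - 4 * int k"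
      using b(2)[OF _ _ that] k by simp
    show "s \<ge> 2 \<and> fill (int s) (2 * int n - 4 * int s) = 4 * (int k)^2 - 4 * int k" if "s = k" for s
      using fill_eq[of 0 "int k" 4] that k by (simp add: algebra_simps power2_eq_square)
    fix H :: "(nat, nat) mgraph"
    assume H: "multigraph H"
    then have fin: "finite (verts H)" by (simp add: multigraph_def)
    have ne: "verts H \<noteq> {}" if "graph_order H = k" using that k by (auto simp: graph_order_def)
    show "ideally_edge_connected H \<and> nearly_regular H \<and> graph_order H = k"
      if "ideally_edge_connected H \<and> regular 6 H \<and> graph_order H = k"
      using that nearly_regular_iff[OF fin ne] by (simp add: regular_def)
    \<comment> \<open>Here \<open>graph_size H = n - k = 3 k\<close>, so the average degree is
      6.\<close>
    show "ideally_edge_connected H \<and> regular 6 H \<and> graph_order H = k"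
      if "ideally_edge_connected H" "nearly_regular H" "graph_order H = k" "graph_order H + graph_size H = n"
      using that nearly_regular_imp_regular[OF H that(2) ne, of 6] k by simp
  qed
  have b: "avg_edge_connectivity G \<le> 2 + ((real n)^2 - 6 * real n + 13) / (4 * real n * (real n - 1))
         \<and> (avg_edge_connectivity G
              = 2 + ((real n)^2 - 6 * real n + 13) / (4 * real n * (real n - 1))
            \<longleftrightarrow> obtained_by_subdividing G (\<lambda>H. ideally_edge_connected H \<and> nearly_regular H
                  \<and> graph_order H = k \<and> graph_size H = n - k))" (is "?B k")
    if k: "n = 4 * k + 1" "k \<ge> 30" for k
  proof (rule extremal[where T = "4 * (int k)^2 - 4 * int k + 2" and S = "\<lambda>s. s = k"])
    note b = bound_mod4_1[OF numeric, of "int k"]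
    show "(real n)^2 - 6 * real n + 13 = 4 * real_of_int (4 * (int k)^2 - 4 * int k + 2)"
      using k by (simp add: power2_eq_square algebra_simps)
    show "2 * int (\<Sum>p\<in>pairs (verts G). tie_weight G p) \<le> 4 * (int k)^2 - 4 * int k + 2"
      using b k by simp
    show "class_size = k \<and> int big_excess = 2 * int n - 4 * int class_size"
      if "2 * int (\<Sum>p\<in>pairs (verts G). tie_weight G p) = 4 * (int k)^2 - 4 * int k + 2"
      using b(2)[OF _ _ that] k by simp
    show "s \<ge> 2 \<and> fill (int s) (2 * int n - 4 * int s) = 4 * (int k)^2 - 4 * int k + 2" if "s = k" for s
      using fill_eq[of 2 "int k" 4] that k by (simp add: algebra_simps power2_eq_square)
  qed auto
  have c: "avg_edge_connectivity G \<le> 2 + ((real n)^2 - 8 * real n + 60) / (4 * real n * (real n - 1))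
         \<and> (avg_edge_connectivity G
              = 2 + ((real n)^2 - 8 * real n + 60) / (4 * real n * (real n - 1))
            \<longleftrightarrow> obtained_by_subdividing G (\<lambda>H. ideally_edge_connected H \<and> nearly_regular H
                  \<and> (graph_order H = k \<and> graph_size H = n - k
                     \<or> graph_order H = k + 1 \<and> graph_size H = n - k - 1)))" (is "?C k")
    if k: "n = 4 * k + 2" "k \<ge> 68" for k
  proof (rule extremal[where T = "4 * (int k)^2 - 4 * int k + 12" and S = "\<lambda>s. s = k \<or> s = k + 1"])
    note b = bound_mod4_2[OF numeric, of "int k"]
    show "(real n)^2 - 8 * real n + 60 = 4 * real_of_int (4 * (int k)^2 - 4 * int k + 12)"
      using k by (simp add: power2_eq_square algebra_simps)
    show "2 * int (\<Sum>p\<in>pairs (verts G). tie_weight G p) \<le> 4 * (int k)^2 - 4 * int k + 12"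
      using b k by simp
    show "(class_size = k \<or> class_size = k + 1) \<and> int big_excess = 2 * int n - 4 * int class_size"
      if "2 * int (\<Sum>p\<in>pairs (verts G). tie_weight G p) = 4 * (int k)^2 - 4 * int k + 12"
      using b(2)[OF _ _ that] k by auto
    show "s \<ge> 2 \<and> fill (int s) (2 * int n - 4 * int s) = 4 * (int k)^2 - 4 * int k + 12"
      if "s = k \<or> s = k + 1" for s
      using that
    proof
      assume "s = k"
      then show ?thesis
        using fill_eq[of 4 "int k" 4] k by (simp add: algebra_simps power2_eq_square)
    next
      \<comment> \<open>\<open>2 n - 4 s = 4 k = 3 (k + 1) + (k - 3)\<close>: three full
        levels.\<close>
      assume "s = k + 1"
      then show ?thesis
        using fill_eq[of "int k - 3" "int k + 1" 3] k by (simp add: algebra_simps power2_eq_square)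
    qed
  qed auto
  have d: "avg_edge_connectivity G \<le> 2 + ((real n)^2 - 6 * real n + 17) / (4 * real n * (real n - 1))
         \<and> (avg_edge_connectivity G
              = 2 + ((real n)^2 - 6 * real n + 17) / (4 * real n * (real n - 1))
            \<longleftrightarrow> obtained_by_subdividing G (\<lambda>H. ideally_edge_connected H \<and> nearly_regular H
                  \<and> graph_order H = k + 1 \<and> graph_size H = n - k - 1))" (is "?D k")
    if k: "n = 4 * k + 3" "k \<ge> 30" for k
  proof (rule extremal[where T = "4 * (int k)^2 + 2" and S = "\<lambda>s. s = k + 1"])
    note b = bound_mod4_3[OF numeric, of "int k"]
    show "(real n)^2 - 6 * real n + 17 = 4 * real_of_int (4 * (int k)^2 + 2)"
      using k by (simp add: power2_eq_square algebra_simps)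
    show "2 * int (\<Sum>p\<in>pairs (verts G). tie_weight G p) \<le> 4 * (int k)^2 + 2"
      using b k by simp
    show "class_size = k + 1 \<and> int big_excess = 2 * int n - 4 * int class_size"
      if "2 * int (\<Sum>p\<in>pairs (verts G). tie_weight G p) = 4 * (int k)^2 + 2"
      using b(2)[OF _ _ that] k by auto
    \<comment> \<open>\<open>2 n - 4 (k + 1) = 4 k + 2 = 3 (k + 1) + (k - 1)\<close>: three full
      levels.\<close>
    show "s \<ge> 2 \<and> fill (int s) (2 * int n - 4 * int s) = 4 * (int k)^2 + 2" if "s = k + 1" for s
      using fill_eq[of "int k - 1" "int k + 1" 3] that k by (simp add: algebra_simps power2_eq_square)
  qed auto
  have "(k \<ge> 8 \<and> l = 0 \<longrightarrow> ?A k) \<and> (k \<ge> 30 \<and> l = 1 \<longrightarrow> ?B k) \<and> (k \<ge> 68 \<and> l = 2 \<longrightarrow> ?C k) \<and>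
      (k \<ge> 30 \<and> l = 3 \<longrightarrow> ?D k)" if "n = 4 * k + l \<and> l < 4" for k l
    using that a[of k] b[of k] c[of k] d[of k] by (intro conjI impI) (simp_all only: add_0_right)
  then show ?thesis using general less by blast
qed

end
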